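(* Let $\Omega$ be a bounded domain in $M$ with smooth boundary $\partial\Omega$ and let $f\in C^1(\overline{\Omega},\mathbb{A})$. Then $T[f]$ is differentiable in $\Omega$ with $$\partial_sT[f](x)=-\int_{\Omega}\partial_sE_y(x)\,f(y)\,dV(y)+v_s^{c}\,\frac{f(x)}{m+1},\qquad x\in\Omega,\ s=0,1,\ldots,m,$$ where $\partial_s E_y(x)$ denotes the partial derivative with respect to $x_s$ and the integral is taken in the sense of Cauchy's principal value. In particular, $$\overline{\partial}_{\mathcal{B}}T[f](x)=f(x),\qquad x\in\Omega.$$
   Context: $\mathbb{A}$ is a real algebra with unity (with $\mathbb{R}$ identified with $\mathbb{R}\cdot 1$), of finite real dimension greater than $1$, which is alternative (not necessarily associative or commutative): the associator $[a,b,c]=(ab)c-a(bc)$ is an alternating trilinear function. It is equipped with an anti-involution $a\mapsto a^{c}$, i.e. a real linear map with $a^{c}=a$ for $a\in\mathbb{R}$, $(a^{c})^{c}=a$, $(ab)^{c}=b^{c}a^{c}$. Put $t(x)=x+x^{c}$, $n(x)=xx^{c}$, $\mathbb{S}_{\mathbb{A}}=\{x\in\mathbb{A}: t(x)=0,\ n(x)=1\}$ (assumed nonempty), and $Q_{\mathbb{A}}=\mathbb{R}\cup\{x\in\mathbb{A}: t(x)\in\mathbb{R},\ n(x)\in\mathbb{R},\ 4n(x)>t(x)^2\}$. $M$ is a fixed hypercomplex subspace of $\mathbb{A}$, i.e. a real vector subspace with $\mathbb{R}\subsetneq M\subseteq Q_{\mathbb{A}}$, with a fixed hypercomplex basis $\mathcal{B}=(v_0,v_1,\ldots,v_m)$,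 $m\ge 1$: a real vector basis of $M$ with $v_0=1$, $v_s\in\mathbb{S}_{\mathbb{A}}$ for $1\le s\le m$ and $v_sv_t=-v_tv_s$ for distinct $s,t\in\{1,\ldots,m\}$. The basis $\mathcal{B}$ is completed to a real vector basis of $\mathbb{A}$, and $\mathbb{A}$ carries the Euclidean scalar product and norm $|\cdot|$ for which that basis is orthonormal. $\mathbb{R}^{m+1}$ is identified with $M$ via $(x_0,\ldots,x_m)\mapsto x=\sum_{s=0}^m x_sv_s$. A domain is a connected open set. Differentiability classes and integrals of $\mathbb{A}$-valued functions are understood componentwise, $dV$ is the Lebesgue volume element in $\mathbb{R}^{m+1}$, $\partial_s=\partial/\partial x_s$ and $\overline{\partial}_{\mathcal{B}}f=\sum_{s=0}^m v_s\,\partial_s f$. The Cauchy kernel is $E(x)=\frac{1}{\sigma_m}\frac{x^c}{|x|^{m+1}}$ for $x\in M\setminus\{0\}$, where $\sigma_m=2\frac{\Gamma(1/2)^{m+1}}{\Gamma((m+1)/2)}$, and $E_y(x):=E(y-x)$. With $B(x,\epsilon)=\{y\in M:|y-x|<\epsilon\}$, the Teodorescu transform of $f\in C^1(\overline{\Omega},\mathbb{A})$ is $$T[f](x)=-\int_\Omega E_y(x)f(y)\,dV(y)=-\lim_{\epsilon\to0}\int_{\Omega\setminus B(x,\epsilon)}E_y(x)f(y)\,dV(y),\qquad x\in\Omega.$$ Cauchy's principal value of an integral singular at $y=x$ means the analogous limit of integrals over $\Omega\setminus B(x,\epsilon)$ as $\epsilon\to0$. *)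

theory Defs
  imports "HOL-Analysis.Analysis"
begin

section \<open>Alternative algebras with an anti-involution\<close>

text \<open>The multiplication is neither associative nor commutative, so the library class
  \<open>real_algebra_1\<close> does not apply; the real number \<open>r\<close> is identified with \<open>r *\<^sub>R 1\<close>.
  Finite dimension is obtained by adding the sort \<open>euclidean_space\<close>, whose inner product
  is a priori unrelated to the multiplication.\<close>

class alternative_star_algebra = real_vector + one + times +
  fixes star :: "'a \<Rightarrow> 'a"
  assumes alt_mult_add_left: "(a + b) * c = a * c + b * c"
    and alt_mult_add_right: "a * (b + c) = a * b + a * c"
    and alt_mult_scaleR_left: "(r *\<^sub>R a) * b = r *\<^sub>R (a * b)"
    and alt_mult_scaleR_right: "a * (r *\<^sub>R b) = r *\<^sub>R (a * b)"
    and alt_one_mult: "1 * a = a"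
    and alt_mult_one: "a * 1 = a"
    and associator_alternating:
      "(a * a) * b - a * (a * b) = 0"
      "(a * b) * a - a * (b * a) = 0"
      "(a * b) * b - a * (b * b) = 0"
    and star_add: "star (a + b) = star a + star b"
    and star_scaleR: "star (r *\<^sub>R a) = r *\<^sub>R star a"
    and star_real: "star (r *\<^sub>R 1) = r *\<^sub>R 1"
    and star_star: "star (star a) = a"
    and star_mult: "star (a * b) = star b * star a"

definition alg_reals :: "'a::alternative_star_algebra set"
  where "alg_reals = range (\<lambda>r. r *\<^sub>R 1)"

definition alg_trace :: "'a::alternative_star_algebra \<Rightarrow> 'a"
  where "alg_trace x = x + star x"

definition alg_norm :: "'a::alternative_star_algebra \<Rightarrow> 'a"
  where "alg_norm x = x * star x"

definition imag_sphere :: "'a::alternative_star_algebra set"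
  where "imag_sphere = {x. alg_trace x = 0 \<and> alg_norm x = 1}"

definition quadratic_cone :: "'a::alternative_star_algebra set"
  where "quadratic_cone = alg_reals \<union>
    {x. \<exists>\<tau> \<nu>::real. alg_trace x = \<tau> *\<^sub>R 1 \<and> alg_norm x = \<nu> *\<^sub>R 1 \<and> 4 * \<nu> > \<tau>\<^sup>2}"

definition hypercomplex_subspace :: "'a::alternative_star_algebra set \<Rightarrow> bool"
  where "hypercomplex_subspace M \<longleftrightarrow> subspace M \<and> alg_reals \<subset> M \<and> M \<subseteq> quadratic_cone"

text \<open>The basis \<open>v\<^sub>0, \<dots>, v\<^sub>m\<close> is indexed by a finite type \<open>'n\<close> with \<open>m + 1\<close> elements. The class
  \<open>zero\<close> only singles out the element of \<open>'n\<close> that plays the role of the index \<open>0\<close>.\<close>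

definition hypercomplex_basis ::
    "'a::alternative_star_algebra set \<Rightarrow> ('n::{finite,zero} \<Rightarrow> 'a) \<Rightarrow> bool"
  where "hypercomplex_basis M v \<longleftrightarrow>
    inj v \<and> independent (range v) \<and> span (range v) = M \<and>
    v 0 = 1 \<and> (\<forall>s. s \<noteq> 0 \<longrightarrow> v s \<in> imag_sphere) \<and>
    (\<forall>s t. s \<noteq> 0 \<longrightarrow> t \<noteq> 0 \<longrightarrow> s \<noteq> t \<longrightarrow> v s * v t = - (v t * v s))"

definition orthonormal_basis :: "'a::euclidean_space set \<Rightarrow> bool"
  where "orthonormal_basis W \<longleftrightarrow>
    independent W \<and> span W = UNIV \<and> pairwise orthogonal W \<and> (\<forall>w\<in>W. norm w = 1)"

text \<open>The identification of Euclidean space with the span of \<open>v\<close>. Domains and functions on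
  them live in coordinate space \<open>real ^ 'n\<close>.\<close>

definition embed :: "('n::finite \<Rightarrow> 'a::real_vector) \<Rightarrow> real ^ 'n \<Rightarrow> 'a"
  where "embed v x = (\<Sum>s\<in>UNIV. x $ s *\<^sub>R v s)"


section \<open>Partial derivatives, regularity of functions and of domains\<close>

definition has_partial ::
    "'n::finite \<Rightarrow> (real ^ 'n \<Rightarrow> 'a::real_normed_vector) \<Rightarrow> 'a \<Rightarrow> real ^ 'n \<Rightarrow> bool"
  where "has_partial s F D x \<longleftrightarrow>
    ((\<lambda>t. F (x + t *\<^sub>R axis s 1)) has_vector_derivative D) (at 0)"

definition partial ::
    "'n::finite \<Rightarrow> (real ^ 'n \<Rightarrow> 'a::real_normed_vector) \<Rightarrow> real ^ 'n \<Rightarrow> 'a"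
  where "partial s F x = vector_derivative (\<lambda>t. F (x + t *\<^sub>R axis s 1)) (at 0)"

text \<open>\<open>C\<^sup>k\<close> regularity on an open set.\<close>

primrec Ck_on :: "nat \<Rightarrow> (real ^ 'n::finite) set \<Rightarrow> (real ^ 'n \<Rightarrow> real) \<Rightarrow> bool"
  where
    "Ck_on 0 U g \<longleftrightarrow> continuous_on U g"
  | "Ck_on (Suc k) U g \<longleftrightarrow> continuous_on U g \<and>
      (\<exists>D. \<forall>s. (\<forall>x\<in>U. has_partial s g (D s x) x) \<and> Ck_on k U (D s))"

text \<open>\<open>C\<^sup>1\<close> up to the boundary of an open set \<open>\<Omega>\<close>: the function and its first order partial
  derivatives on \<open>\<Omega>\<close> extend continuously to the closure.\<close>

definition C1_closure :: "(real ^ 'n::finite) set \<Rightarrow> (real ^ 'n \<Rightarrow> 'a::real_normed_vector) \<Rightarrow> bool"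
  where "C1_closure \<Omega> f \<longleftrightarrow> continuous_on (closure \<Omega>) f \<and>
    (\<exists>D. \<forall>s. (\<forall>x\<in>\<Omega>. has_partial s f (D s x) x) \<and> continuous_on (closure \<Omega>) (D s))"

text \<open>Near every boundary point, \<open>\<Omega>\<close> is a sublevel set of a \<open>C\<^sup>\<infinity>\<close> function with nowhere
  vanishing gradient.\<close>

definition smooth_boundary :: "(real ^ 'n::finite) set \<Rightarrow> bool"
  where "smooth_boundary \<Omega> \<longleftrightarrow>
    (\<forall>p\<in>frontier \<Omega>. \<exists>U \<rho>. open U \<and> p \<in> U \<and> (\<forall>k. Ck_on k U \<rho>) \<and>
       (\<forall>x\<in>U. \<exists>s. partial s \<rho> x \<noteq> 0) \<and> \<Omega> \<inter> U = {x\<in>U. \<rho> x < 0})"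


section \<open>Cauchy kernel, Teodorescu transform and Cauchy-Riemann operator\<close>

definition sphere_area :: "nat \<Rightarrow> real"
  where "sphere_area m = 2 * (Gamma (1/2) ^ (m + 1) / Gamma ((real m + 1) / 2))"

definition cauchy_kernel :: "nat \<Rightarrow> 'a::{euclidean_space,alternative_star_algebra} \<Rightarrow> 'a"
  where "cauchy_kernel m x = (1 / sphere_area m) *\<^sub>R ((1 / norm x ^ (m + 1)) *\<^sub>R star x)"

text \<open>\<open>kernel_at m v y x\<close> is \<open>E\<^sub>y(x) = E(y - x)\<close>, as a function of coordinates.\<close>

definition kernel_at ::
    "nat \<Rightarrow> ('n::finite \<Rightarrow> 'a::{euclidean_space,alternative_star_algebra}) \<Rightarrow>
      real ^ 'n \<Rightarrow> real ^ 'n \<Rightarrow> 'a"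
  where "kernel_at m v y x = cauchy_kernel m (embed v y - embed v x)"

definition teodorescu ::
    "nat \<Rightarrow> ('n::finite \<Rightarrow> 'a::{euclidean_space,alternative_star_algebra}) \<Rightarrow>
      (real ^ 'n) set \<Rightarrow> (real ^ 'n \<Rightarrow> 'a) \<Rightarrow> real ^ 'n \<Rightarrow> 'a"
  where "teodorescu m v \<Omega> f x = - (LINT y:\<Omega>|lborel. kernel_at m v y x * f y)"

definition has_pv_integral ::
    "(real ^ 'n::finite) set \<Rightarrow> real ^ 'n \<Rightarrow> (real ^ 'n \<Rightarrow> 'a::euclidean_space) \<Rightarrow> 'a \<Rightarrow> bool"
  where "has_pv_integral \<Omega> x h I \<longleftrightarrow>
    (\<forall>\<epsilon>>0. set_integrable lborel (\<Omega> - ball x \<epsilon>) h) \<and>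
    ((\<lambda>\<epsilon>. LINT y:\<Omega> - ball x \<epsilon>|lborel. h y) \<longlongrightarrow> I) (at_right 0)"

definition dbar ::
    "('n::finite \<Rightarrow> 'a::{euclidean_space,alternative_star_algebra}) \<Rightarrow>
      (real ^ 'n \<Rightarrow> 'a) \<Rightarrow> real ^ 'n \<Rightarrow> 'a"
  where "dbar v F x = (\<Sum>s\<in>UNIV. v s * partial s F x)"

end

theory Submission
  imports Defs
begin

text \<open>Write \<open>d = m + 1\<close> and \<open>K(z) = z / |z|\<^sup>d\<close>. By linearity of the conjugation, \<open>E\<^sub>y(x) f(y)\<close> is
  \<open>P (K(y - x)) (f y)\<close> for a bilinear map \<open>P\<close> with values in the algebra, so the first claim concerns
  potentials with kernel \<open>K\<close>. Near \<open>x\<^sub>0\<close> write the density as a constant on a ball around \<open>x\<^sub>0\<close> plus a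
  remainder bounded by a multiple of \<open>|y - x\<^sub>0|\<close>. For the remainder the differentiated integral
  converges absolutely and differentiation under the integral sign is legitimate at \<open>x\<^sub>0\<close>. The
  potential of the ball has derivative \<open>h \<mapsto> - \<omega>\<^sub>d h\<close> at its centre, where \<open>\<omega>\<^sub>d\<close> is the volume of the
  unit ball, independently of the radius; hence the derivative of \<open>K\<close> integrates to zero over
  annuli, which gives the principal value, and \<open>\<omega>\<^sub>d / \<sigma>\<^sub>m = 1 / d\<close> gives the local term. The formula
  for the Cauchy-Riemann operator then follows from \<open>v\<^sub>s (v\<^sub>t\<^sup>c a) + v\<^sub>t (v\<^sub>s\<^sup>c a) = 2 \<delta>\<^sub>s\<^sub>t a\<close>, a
  consequence of the left alternative law that replaces associativity.\<close>

section \<open>The kernel and its derivative\<close>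

text \<open>Up to a constant factor the gradient of the fundamental solution of the Laplacian in
  dimension d = \<open>DIM('e)\<close>. Since 1 / 0 = 0, its value at the origin is 0.\<close>

definition newton_kernel :: "'e::euclidean_space \<Rightarrow> 'e"
  where "newton_kernel z = (1 / norm z ^ DIM('e)) *\<^sub>R z"

text \<open>The derivative of the kernel at z in direction h; it too is 0 at the origin by
  convention.\<close>

definition newton_kernel_deriv :: "'e::euclidean_space \<Rightarrow> 'e \<Rightarrow> 'e"
  where "newton_kernel_deriv z h = (1 / norm z ^ DIM('e)) *\<^sub>R h
    - (real DIM('e) * (z \<bullet> h) / norm z ^ (DIM('e) + 2)) *\<^sub>R z"

text \<open>The locally integrable majorant |z|^(1-d) of the kernel. At the origin its value is 0,
  or 1 when d = 1.\<close>

definition radial_weight :: "'e::euclidean_space \<Rightarrow> real"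
  where "radial_weight z = 1 / norm z ^ (DIM('e) - 1)"

lemma radial_weight_nonneg [simp]: "0 \<le> radial_weight z"
  by (simp add: radial_weight_def)

lemma borel_measurable_newton [measurable]:
  "newton_kernel \<in> borel_measurable borel"
  "(\<lambda>z. newton_kernel_deriv z h) \<in> borel_measurable borel"
  "radial_weight \<in> borel_measurable borel"
  unfolding newton_kernel_def newton_kernel_deriv_def radial_weight_def by measurable

lemma newton_kernel_minus: "newton_kernel (- z) = - newton_kernel z"
  by (simp add: newton_kernel_def)

lemma norm_divide_power_DIM:
  fixes z :: "'e::euclidean_space"
  assumes "z \<noteq> 0"
  shows "norm z / norm z ^ DIM('e) = radial_weight z"
proof -
  have "norm z ^ DIM('e) = norm z * norm z ^ (DIM('e) - 1)"
    by (metis DIM_positive power_eq_if not_less0)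
  with assms show ?thesis
    by (simp add: radial_weight_def)
qed

lemma norm_newton_kernel_le: "norm (newton_kernel z) \<le> radial_weight z"
proof (cases "z = 0")
  case False
  then show ?thesis
    using norm_divide_power_DIM[OF False] by (simp add: newton_kernel_def)
qed (simp add: newton_kernel_def)

lemma linear_newton_kernel_deriv: "linear (newton_kernel_deriv z)"
  by (rule linearI) (simp_all add: newton_kernel_deriv_def inner_add_right add_divide_distrib
      scaleR_add_left scaleR_add_right algebra_simps)

text \<open>The first term contributes 1 to the constant and the radial term, by Cauchy-Schwarz,
  contributes d. The order |z|^(-d) is critical: it is not integrable at the origin.\<close>

lemma norm_newton_kernel_deriv_le:
  fixes z h :: "'e::euclidean_space"
  shows "norm (newton_kernel_deriv z h) \<le> (real DIM('e) + 1) * norm h / norm z ^ DIM('e)"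
proof (cases "z = 0")
  case False
  let ?d = "DIM('e)"
  have "norm ((real ?d * (z \<bullet> h) / norm z ^ (?d + 2)) *\<^sub>R z)
      = real ?d * (\<bar>z \<bullet> h\<bar> * norm z) / norm z ^ (?d + 2)"
    by (simp add: abs_mult)
  also have "\<dots> \<le> real ?d * ((norm z * norm h) * norm z) / norm z ^ (?d + 2)"
    by (intro divide_right_mono mult_left_mono mult_right_mono Cauchy_Schwarz_ineq2) auto
  also have "\<dots> = real ?d * norm h / norm z ^ ?d"
    using False by (simp add: power_add power2_eq_square)
  finally have 1: "norm ((real ?d * (z \<bullet> h) / norm z ^ (?d + 2)) *\<^sub>R z)
      \<le> real ?d * norm h / norm z ^ ?d" .
  have "norm (newton_kernel_deriv z h) \<le> norm ((1 / norm z ^ ?d) *\<^sub>R h)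
      + norm ((real ?d * (z \<bullet> h) / norm z ^ (?d + 2)) *\<^sub>R z)"
    unfolding newton_kernel_deriv_def by (rule norm_triangle_ineq4)
  also have "\<dots> \<le> norm h / norm z ^ ?d + real ?d * norm h / norm z ^ ?d"
    using 1 by simp
  also have "\<dots> = (real ?d + 1) * norm h / norm z ^ ?d"
    by (simp add: add_divide_distrib algebra_simps)
  finally show ?thesis .
qed (simp add: newton_kernel_deriv_def power_0_left)

lemma has_derivative_newton_kernel:
  fixes z :: "'e::euclidean_space"
  assumes "z \<noteq> 0"
  shows "(newton_kernel has_derivative newton_kernel_deriv z) (at z)"
proof -
  let ?d = "DIM('e)"
  have "(norm has_derivative (\<lambda>h. inner (sgn z) h)) (at z)"
    using has_derivative_norm[OF assms] by (simp add: inner_commute)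
  from has_derivative_power[OF this, of ?d] have "((\<lambda>x. norm x ^ ?d) has_derivative
      (\<lambda>h. real ?d * (inner (sgn z) h) * norm z ^ (?d - 1))) (at z)"
    by (simp add: ac_simps)
  then have "((\<lambda>x. inverse (norm x ^ ?d)) has_derivative
      (\<lambda>h. - (inverse (norm z ^ ?d) * (real ?d * (inner (sgn z) h) * norm z ^ (?d - 1)) *
           inverse (norm z ^ ?d)))) (at z)"
    using assms by (intro Deriv.has_derivative_inverse) auto
  moreover have "- (inverse (norm z ^ ?d) * (real ?d * (inner (sgn z) h) * norm z ^ (?d - 1)) *
           inverse (norm z ^ ?d)) = - (real ?d * (z \<bullet> h) / norm z ^ (?d + 2))" for h
  proof -
    have "norm z ^ ?d = norm z * norm z ^ (?d - 1)"
      by (metis DIM_positive power_eq_if not_less0)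
    then show ?thesis using assms
      by (simp add: sgn_div_norm power_add power2_eq_square divide_simps)
  qed
  ultimately have 1: "((\<lambda>x. inverse (norm x ^ ?d)) has_derivative
      (\<lambda>h. - (real ?d * (z \<bullet> h) / norm z ^ (?d + 2)))) (at z)"
    by simp
  have "((\<lambda>x. inverse (norm x ^ ?d) *\<^sub>R x) has_derivative
     (\<lambda>h. inverse (norm z ^ ?d) *\<^sub>R h + (- (real ?d * (z \<bullet> h) / norm z ^ (?d + 2))) *\<^sub>R z)) (at z)"
    by (rule has_derivative_scaleR[OF 1 has_derivative_ident])
  then show ?thesis
    by (simp add: newton_kernel_def[abs_def] newton_kernel_deriv_def[abs_def] inverse_eq_divide)
qed

text \<open>Mean value inequality on the ball of radius |z|/2 around z: there |x| is at least |z|/2,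
  which costs the factor 2^d.\<close>

lemma newton_kernel_lipschitz:
  fixes z h :: "'e::euclidean_space"
  assumes "2 * norm h \<le> norm z" "z \<noteq> 0"
  shows "norm (newton_kernel (z + h) - newton_kernel z)
    \<le> (real DIM('e) + 1) * 2 ^ DIM('e) * norm h / norm z ^ DIM('e)"
proof -
  let ?d = "DIM('e)"
  let ?S = "cball z (norm z / 2)"
  have big: "norm z / 2 \<le> norm x" if "x \<in> ?S" for x
  proof -
    have "norm z - norm x \<le> norm (z - x)" by (rule norm_triangle_ineq2)
    moreover have "norm (z - x) \<le> norm z / 2" using that by (simp add: dist_norm)
    ultimately show ?thesis by linarith
  qed
  have "norm (newton_kernel (z + h) - newton_kernel z)
      \<le> (real ?d + 1) * 2 ^ ?d / norm z ^ ?d * norm ((z + h) - z)"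
  proof (rule differentiable_bound[of ?S newton_kernel newton_kernel_deriv _ "z + h" z])
    show "(newton_kernel has_derivative newton_kernel_deriv x) (at x within ?S)" if "x \<in> ?S" for x
    proof -
      have "x \<noteq> 0"
        using big[OF that] assms(2) by auto
      then show ?thesis
        by (rule has_derivative_at_withinI[OF has_derivative_newton_kernel])
    qed
    show "onorm (newton_kernel_deriv x) \<le> (real ?d + 1) * 2 ^ ?d / norm z ^ ?d" if "x \<in> ?S" for x
    proof (rule onorm_le)
      fix h :: 'e
      have "0 < norm x"
        using big[OF that] assms(2) by auto
      then have "(real ?d + 1) * norm h / norm x ^ ?d \<le> (real ?d + 1) * norm h / (norm z / 2) ^ ?d"
        using big[OF that] assms(2) by (intro divide_left_mono power_mono mult_pos_pos) (auto)
      then have "(real ?d + 1) * norm h / norm x ^ ?d \<le> (real ?d + 1) * 2 ^ ?d / norm z ^ ?d * norm h"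
        by (simp add: power_divide mult.commute mult.left_commute)
      with norm_newton_kernel_deriv_le[of x h]
      show "norm (newton_kernel_deriv x h) \<le> (real ?d + 1) * 2 ^ ?d / norm z ^ ?d * norm h"
        by (rule order_trans)
    qed
    show "z + h \<in> ?S" "z \<in> ?S"
      using assms(1) by (auto simp: dist_norm)
  qed auto
  then show ?thesis
    by simp
qed

section \<open>Integrability of the kernel\<close>

lemma nn_integral_translation:
  fixes a :: "'e::euclidean_space"
  assumes [measurable]: "f \<in> borel_measurable borel"
  shows "(\<integral>\<^sup>+x. f (a + x) \<partial>lborel) = (\<integral>\<^sup>+x. f x \<partial>lborel)"
  by (subst (2) lborel_distr_plus[of a, symmetric]) (simp add: nn_integral_distr)

lemma integral_translation:
  fixes a :: "'e::euclidean_space" and f :: "'e \<Rightarrow> 'b::{banach, second_countable_topology}"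
  assumes [measurable]: "f \<in> borel_measurable borel"
  shows "(\<integral>x. f (a + x) \<partial>lborel) = (\<integral>x. f x \<partial>lborel)"
  by (subst (2) lborel_distr_plus[of a, symmetric]) (simp add: integral_distr)

lemma lborel_distr_uminus_euclidean:
  "distr lborel borel uminus = (lborel :: 'e::euclidean_space measure)"
  by (subst lborel_affine[of "-1" 0]) (auto simp: density_1 one_ennreal_def[symmetric])

text \<open>Reflection preserves Lebesgue measure, so the integral equals its own negative.\<close>

lemma integral_odd_eq_0:
  fixes f :: "'e::euclidean_space \<Rightarrow> 'b::{banach, second_countable_topology}"
  assumes [measurable]: "f \<in> borel_measurable borel" and odd: "\<And>x. f (- x) = - f x"
  shows "(\<integral>x. f x \<partial>lborel) = 0"
proof -
  have "(\<integral>x. f x \<partial>lborel) = (\<integral>x. f x \<partial>(distr lborel borel uminus))"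
    by (simp add: lborel_distr_uminus_euclidean)
  also have "\<dots> = - (\<integral>x. f x \<partial>lborel)"
    by (simp add: integral_distr odd)
  finally show ?thesis
    by (simp add: eq_neg_iff_add_eq_0 flip: scaleR_2)
qed

text \<open>The dyadic shell of radius \<open>\<rho> / 2 ^ k\<close> contributes \<open>O(\<rho> / 2 ^ k)\<close>.\<close>

lemma nn_integral_radial_weight_le:
  fixes \<rho> :: real
  assumes "\<rho> > 0"
  shows "(\<integral>\<^sup>+z. ennreal (indicator (ball (0::'e::euclidean_space) \<rho>) z * radial_weight z) \<partial>lborel)
    \<le> ennreal (2 ^ DIM('e) * unit_ball_vol DIM('e) * \<rho>)"
proof -
  let ?d = "DIM('e)"
  define c where "c k = (2 ^ Suc k / \<rho>) ^ (?d - 1)" for k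
  define B where "B k = ball (0::'e) (\<rho> / 2 ^ k)" for k :: nat
  have [measurable]: "B k \<in> sets borel" for k
    by (simp add: B_def)
  have cpos: "c k \<ge> 0" for k
    using assms by (simp add: c_def)
  have "(\<integral>\<^sup>+z. ennreal (indicator (ball (0::'e) \<rho>) z * radial_weight z) \<partial>lborel)
      \<le> (\<integral>\<^sup>+z. (\<Sum>k. ennreal (c k) * indicator (B k) z) \<partial>lborel)"
  proof (rule nn_integral_mono)
    fix z :: 'e
    show "ennreal (indicator (ball 0 \<rho>) z * radial_weight z)
        \<le> (\<Sum>k. ennreal (c k) * indicator (B k) z)"
    proof (cases "z \<in> ball 0 \<rho>")
      case True
      have "\<exists>k. z \<in> B k \<and> radial_weight z \<le> c k"
      proof (cases "z = 0")
        case True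
        \<comment> \<open>At the origin the weight is 0, or 1 in dimension one, where
          \<open>c 0\<close> is 1 as well.\<close>
        then show ?thesis
          using assms by (intro exI[of _ 0]) (auto simp: B_def radial_weight_def c_def power_0_left)
      next
        case False
        have "\<exists>k. \<rho> / 2 ^ k \<le> norm z"
        proof -
          obtain k where "\<rho> / norm z < 2 ^ k"
            using real_arch_pow[of 2 "\<rho> / norm z"] by auto
          then show ?thesis
            using False by (intro exI[of _ k]) (simp add: field_simps)
        qed
        \<comment> \<open>The first radius not exceeding |z| belongs to the index K; the index
          before it still has |z| below its radius, so it is the one of the shell.\<close>
        define K where "K = (LEAST k. \<rho> / 2 ^ k \<le> norm z)"
        have K: "\<rho> / 2 ^ K \<le> norm z"
          unfolding K_def using \<open>\<exists>k. _\<close> by (rule LeastI_ex)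
        have "K \<noteq> 0"
          using K True by (intro notI) simp
        then obtain k where k: "K = Suc k"
          using not0_implies_Suc by blast
        have "\<not> \<rho> / 2 ^ k \<le> norm z"
          using not_less_Least[of k "\<lambda>k. \<rho> / 2 ^ k \<le> norm z"] k by (simp add: K_def)
        then have "z \<in> B k"
          by (simp add: B_def)
        moreover have "radial_weight z \<le> c k"
        proof -
          have "1 / norm z \<le> 2 ^ Suc k / \<rho>"
            using K k assms False by (simp add: field_simps)
          then have "(1 / norm z) ^ (?d - 1) \<le> c k"
            unfolding c_def by (intro power_mono) auto
          then show ?thesis
            by (simp add: radial_weight_def power_divide)
        qed
        ultimately show ?thesis by blast
      qed
      then obtain k where k: "z \<in> B k" "radial_weight z \<le> c k" by blast
      define F where "F j = ennreal (c j) * indicator (B j) z" for j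
      have "ennreal (indicator (ball 0 \<rho>) z * radial_weight z) \<le> F k"
        unfolding F_def using k True by (simp add: ennreal_leI)
      also have "\<dots> = (\<Sum>j\<in>{k}. F j)"
        by simp
      also have "\<dots> \<le> (\<Sum>j. F j)"
        by (rule sum_le_suminf) auto
      finally show ?thesis
        by (simp add: F_def)
    qed simp
  qed
  also have "\<dots> = (\<Sum>k. \<integral>\<^sup>+z. ennreal (c k) * indicator (B k) z \<partial>lborel)"
    by (rule nn_integral_suminf) measurable
  also have "\<dots> = (\<Sum>k. ennreal (2 ^ ?d * unit_ball_vol ?d * \<rho> * (1/2) ^ Suc k))"
  proof (rule suminf_cong)
    fix k
    have "(\<integral>\<^sup>+z. ennreal (c k) * indicator (B k) z \<partial>lborel) = ennreal (c k) * emeasure lborel (B k)"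
      by (simp add: nn_integral_cmult_indicator)
    also have "\<dots> = ennreal (c k * (unit_ball_vol ?d * (\<rho> / 2 ^ k) ^ ?d))"
      using assms cpos by (simp add: B_def emeasure_ball ennreal_mult)
    \<comment> \<open>Of the d radius factors of the volume, d - 1 pair with those of
      \<open>c k\<close> to give 2 each; the remaining one, \<open>\<rho> / 2 ^ k\<close>, makes the
      series geometric.\<close>
    also have "c k * (unit_ball_vol ?d * (\<rho> / 2 ^ k) ^ ?d)
        = 2 ^ ?d * unit_ball_vol ?d * \<rho> * (1/2) ^ Suc k"
    proof -
      obtain e where e: "?d = Suc e"
        using DIM_positive[where 'a='e] gr0_conv_Suc by blast
      have "c k * (\<rho> / 2 ^ k) ^ ?d = ((2 ^ Suc k / \<rho>) * (\<rho> / 2 ^ k)) ^ e * (\<rho> / 2 ^ k)"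
        unfolding c_def e power_mult_distrib by simp
      also have "(2 ^ Suc k / \<rho>) * (\<rho> / 2 ^ k) = 2"
        using assms by simp
      finally have "c k * (\<rho> / 2 ^ k) ^ ?d = 2 ^ ?d * \<rho> * (1/2) ^ Suc k"
        by (simp add: e power_one_over)
      then show ?thesis
        by (simp add: algebra_simps)
    qed
    finally show "(\<integral>\<^sup>+z. ennreal (c k) * indicator (B k) z \<partial>lborel)
        = ennreal (2 ^ ?d * unit_ball_vol ?d * \<rho> * (1/2) ^ Suc k)" .
  qed
  also have "\<dots> = ennreal (2 ^ ?d * unit_ball_vol ?d * \<rho>)"
  proof (rule suminf_ennreal_eq)
    show "(\<lambda>k. 2 ^ ?d * unit_ball_vol ?d * \<rho> * (1/2) ^ Suc k) sums (2 ^ ?d * unit_ball_vol ?d * \<rho>)"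
      using sums_mult[OF power_half_series] by fastforce
  qed (use assms in auto)
  finally show ?thesis .
qed

text \<open>The shell estimate, moved to the centre a. Because the bound is linear in the radius,
  small neighbourhoods of the singularity contribute only O(|h|) later.\<close>

lemma radial_weight_ball:
  fixes a :: "'e::euclidean_space"
  assumes "\<rho> > 0"
  shows "integrable lborel (\<lambda>y. indicator (ball a \<rho>) y * radial_weight (y - a))"
    and "(\<integral>y. indicator (ball a \<rho>) y * radial_weight (y - a) \<partial>lborel)
      \<le> 2 ^ DIM('e) * unit_ball_vol DIM('e) * \<rho>"
proof -
  let ?f = "\<lambda>y. indicator (ball a \<rho>) y * radial_weight (y - a)"
  let ?C = "2 ^ DIM('e) * unit_ball_vol DIM('e) * \<rho>"
  have [measurable]: "ball a \<rho> \<in> sets borel"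
    by simp
  have "(\<integral>\<^sup>+y. ennreal (?f y) \<partial>lborel) = (\<integral>\<^sup>+y. ennreal (?f (a + y)) \<partial>lborel)"
    by (rule nn_integral_translation[symmetric]) measurable
  also have "\<dots> = (\<integral>\<^sup>+z. ennreal (indicator (ball (0::'e) \<rho>) z * radial_weight z) \<partial>lborel)"
    by (intro nn_integral_cong) (simp add: indicator_def dist_norm)
  also have "\<dots> \<le> ennreal ?C"
    by (rule nn_integral_radial_weight_le[OF assms])
  finally have le: "(\<integral>\<^sup>+y. ennreal (?f y) \<partial>lborel) \<le> ennreal ?C" .
  show int: "integrable lborel ?f"
    using le by (intro integrableI_nonneg) (auto simp: order_le_less_trans ennreal_less_top)
  have "ennreal (\<integral>y. ?f y \<partial>lborel) = (\<integral>\<^sup>+y. ennreal (?f y) \<partial>lborel)"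
    by (rule nn_integral_eq_integral[OF int, symmetric]) auto
  with le show "(\<integral>y. ?f y \<partial>lborel) \<le> ?C"
    using assms by (metis ennreal_le_iff mult_nonneg_nonneg less_imp_le of_nat_0_le_iff
        unit_ball_vol_nonneg zero_le_numeral zero_le_power)
qed

section \<open>Differentiation of potentials\<close>

lemma borel_measurable_bounded_bilinear:
  fixes P :: "'e::{real_normed_vector,second_countable_topology} \<Rightarrow>
    'b::{real_normed_vector,second_countable_topology} \<Rightarrow> 'c::real_normed_vector"
  assumes P: "bounded_bilinear P"
    and [measurable]: "f \<in> borel_measurable M" "g \<in> borel_measurable M"
  shows "(\<lambda>x. P (f x) (g x)) \<in> borel_measurable M"
proof -
  have "continuous_on UNIV (\<lambda>x. P (fst x) (snd x))"
    by (intro bounded_bilinear.continuous_on[OF P] continuous_intros)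
  then show ?thesis
    by (rule borel_measurable_continuous_Pair[OF assms(2,3)])
qed

text \<open>The integrand is bounded by a multiple of |y - x|^(1-d) on a ball around x that contains
  the support of the density.\<close>

lemma integrable_newton_potential:
  fixes P :: "'e::euclidean_space \<Rightarrow> 'b::euclidean_space \<Rightarrow> 'c::{banach,second_countable_topology}"
  assumes P: "bounded_bilinear P"
    and F[measurable]: "F \<in> borel_measurable borel"
    and bdd: "\<And>y. norm (F y) \<le> C" and supp: "\<And>y. y \<notin> ball a \<rho> \<Longrightarrow> F y = 0"
  shows "integrable lborel (\<lambda>y. P (newton_kernel (y - x)) (F y))"
proof -
  note borel_measurable_bounded_bilinear[OF P, measurable]
  obtain K where K: "K > 0" "\<And>a b. norm (P a b) \<le> norm a * norm b * K"
    using bounded_bilinear.pos_bounded[OF P] by blast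
  \<comment> \<open>By the triangle inequality the ball of this radius around x contains
    \<open>ball a \<rho>\<close>; the absolute value and the added 1 make r positive whatever the
    sign of \<rho>.\<close>
  define r where "r = \<bar>\<rho>\<bar> + dist a x + 1"
  have r: "r > 0"
    unfolding r_def by (meson abs_ge_zero add_nonneg_pos add_nonneg_nonneg zero_le_dist zero_less_one)
  have "integrable lborel (\<lambda>y. (K * C) * (indicator (ball x r) y * radial_weight (y - x)))"
    using radial_weight_ball(1)[OF r] by (intro integrable_mult_right) simp
  then show ?thesis
  proof (rule Bochner_Integration.integrable_bound)
    show "AE y in lborel. norm (P (newton_kernel (y - x)) (F y))
        \<le> norm ((K * C) * (indicator (ball x r) y * radial_weight (y - x)))"
    proof (intro AE_I2)
      fix y
      have C: "0 \<le> C"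
        using bdd[of y] norm_ge_zero order_trans by blast
      show "norm (P (newton_kernel (y - x)) (F y))
        \<le> norm ((K * C) * (indicator (ball x r) y * radial_weight (y - x)))"
      proof (cases "y \<in> ball a \<rho>")
        case True
        then have "y \<in> ball x r"
          using dist_triangle[of x y a] by (auto simp: r_def dist_commute)
        moreover have "norm (P (newton_kernel (y - x)) (F y)) \<le> radial_weight (y - x) * C * K"
          using K(1) by (intro order_trans[OF K(2)] mult_right_mono mult_mono norm_newton_kernel_le bdd) auto
        ultimately show ?thesis
          using K(1) C by (simp add: abs_mult ac_simps)
      next
        case False
        then show ?thesis
          using supp bounded_bilinear.zero_right[OF P] by simp
      qed
    qed
  qed measurable
qed

text \<open>If the density vanishes to first order at \<open>x\<^sub>0\<close>, differentiation under the integral sign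
  is legitimate: the region \<open>dist y x\<^sub>0 < 2 * norm h\<close> contributes \<open>O(norm h)\<close> to the difference
  quotient, and on its complement the dominated convergence theorem applies.\<close>

lemma has_derivative_newton_potential_vanishing:
  fixes P :: "'e::euclidean_space \<Rightarrow> 'b::euclidean_space \<Rightarrow> 'c::{banach,second_countable_topology}"
  assumes P: "bounded_bilinear P"
    and G[measurable]: "G \<in> borel_measurable borel"
    and lip: "\<And>y. norm (G y) \<le> L * norm (y - x0)"
    and supp: "\<And>y. y \<notin> ball x0 \<rho> \<Longrightarrow> G y = 0"
  shows "integrable lborel (\<lambda>y. P (newton_kernel_deriv (y - x0) h) (G y))"
    and "((\<lambda>x. \<integral>y. P (newton_kernel (y - x)) (G y) \<partial>lborel) has_derivative
      (\<lambda>h. - (\<integral>y. P (newton_kernel_deriv (y - x0) h) (G y) \<partial>lborel))) (at x0)"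
proof -
  let ?d = "DIM('e)"
  note borel_measurable_bounded_bilinear[OF P, measurable]
  obtain K where K: "K > 0" "\<And>a b. norm (P a b) \<le> norm a * norm b * K"
    using bounded_bilinear.pos_bounded[OF P] by blast
  have ball_sets [measurable]: "ball x r \<in> sets borel" for x :: 'e and r
    by simp
  define r where "r = \<bar>\<rho>\<bar> + 1"
  have r: "r > 0" "\<And>y. y \<notin> ball x0 r \<Longrightarrow> G y = 0"
    using supp by (auto simp: r_def)
  define L' where "L' = \<bar>L\<bar>"
  have L': "L' \<ge> 0" "\<And>y. norm (G y) \<le> L' * norm (y - x0)"
    unfolding L'_def by (simp, intro order_trans[OF lip] mult_right_mono) auto
  define W where "W y = indicator (ball x0 r) y * radial_weight (y - x0)" for y
  have W0: "W y \<ge> 0" for y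
    by (simp add: W_def)
  have [measurable]: "W \<in> borel_measurable borel"
    unfolding W_def[abs_def] by (intro borel_measurable_times borel_measurable_indicator) simp_all
  have W_int: "integrable lborel W"
    unfolding W_def by (rule radial_weight_ball(1)[OF r(1)])
  have Gx0: "G x0 = 0"
    using lip[of x0] by simp
  text \<open>The factor \<open>norm (y - x0)\<close> in the bound on \<open>G\<close> compensates one order of singularity.\<close>
  have key: "norm (P a (G y)) \<le> K * c * L' * W y"
    if "norm a \<le> c / norm (y - x0) ^ ?d" "0 \<le> c" for a y c
  proof (cases "y \<in> ball x0 r \<and> y \<noteq> x0")
    case True
    have "norm (P a (G y)) \<le> (c / norm (y - x0) ^ ?d) * (L' * norm (y - x0)) * K"
      using K(1) that L' by (intro order_trans[OF K(2)] mult_right_mono mult_mono L'(2)) auto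
    also have "\<dots> = K * c * L' * (norm (y - x0) / norm (y - x0) ^ ?d)"
      by (simp add: field_simps)
    also have "norm (y - x0) / norm (y - x0) ^ ?d = W y"
      using True norm_divide_power_DIM[of "y - x0"] by (simp add: W_def)
    finally show ?thesis .
  next
    case False
    then have "G y = 0"
      using Gx0 r(2) by auto
    then show ?thesis
      using bounded_bilinear.zero_right[OF P] K(1) that(2) L'(1) W0 by simp
  qed
  have deriv_le: "norm (P (newton_kernel_deriv (y - x0) h) (G y))
      \<le> K * ((real ?d + 1) * norm h) * L' * W y" for y h
    by (rule key[OF norm_newton_kernel_deriv_le]) simp
  show int: "integrable lborel (\<lambda>y. P (newton_kernel_deriv (y - x0) h) (G y))" for h
  proof (rule Bochner_Integration.integrable_bound)
    show "integrable lborel (\<lambda>y. K * ((real ?d + 1) * norm h) * L' * W y)"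
      using W_int by (rule integrable_mult_right)
    show "AE y in lborel. norm (P (newton_kernel_deriv (y - x0) h) (G y))
        \<le> norm (K * ((real ?d + 1) * norm h) * L' * W y)"
      by (intro AE_I2 order_trans[OF deriv_le]) simp
  qed measurable
  have Gbdd: "norm (G y) \<le> L' * r" for y
  proof (cases "y \<in> ball x0 r")
    case True
    then show ?thesis
      using L' by (intro order_trans[OF L'(2)[of y]] mult_left_mono) (auto simp: dist_norm norm_minus_commute)
  next
    case False
    then show ?thesis using r L' by simp
  qed
  have int0: "integrable lborel (\<lambda>y. P (newton_kernel (y - x)) (G y))" for x
    by (rule integrable_newton_potential[OF P G Gbdd r(2)])
  define D where "D h = - (\<integral>y. P (newton_kernel_deriv (y - x0) h) (G y) \<partial>lborel)" for h
  have linD: "linear D"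
  proof (rule linearI)
    fix a b
    show "D (a + b) = D a + D b"
      unfolding D_def linear_add[OF linear_newton_kernel_deriv] bounded_bilinear.add_left[OF P]
      by (simp add: Bochner_Integration.integral_add[OF int int])
  next
    fix c a
    show "D (c *\<^sub>R a) = c *\<^sub>R D a"
      unfolding D_def linear_cmul[OF linear_newton_kernel_deriv] bounded_bilinear.scaleR_left[OF P]
      by simp
  qed
  \<comment> \<open>The error of the difference quotient, taken under the integral sign.
    Differentiating \<open>newton_kernel (y - x)\<close> in x produces a minus sign, so subtracting
    the derivative adds \<open>newton_kernel_deriv\<close>.\<close>
  define q where "q h y = P ((1 / norm h) *\<^sub>R
      (newton_kernel (y - x0 - h) - newton_kernel (y - x0) + newton_kernel_deriv (y - x0) h)) (G y)" for h y
  have q_eq: "q h y = (1 / norm h) *\<^sub>R (P (newton_kernel (y - (x0 + h))) (G y)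
      - P (newton_kernel (y - x0)) (G y) + P (newton_kernel_deriv (y - x0) h) (G y))" for h y
    by (simp add: q_def bounded_bilinear.scaleR_left[OF P] bounded_bilinear.add_left[OF P]
        bounded_bilinear.diff_left[OF P] diff_diff_eq)
  have q_int: "integrable lborel (q h)" for h
    unfolding q_eq[abs_def] using int0[of "x0 + h"] int0[of x0] int[of h] by simp
  have [measurable]: "q h \<in> borel_measurable borel" for h
    unfolding q_def by measurable
  have quot: "(1 / norm h) *\<^sub>R ((\<integral>y. P (newton_kernel (y - (x0 + h))) (G y) \<partial>lborel)
      - (\<integral>y. P (newton_kernel (y - x0)) (G y) \<partial>lborel) - D h) = (\<integral>y. q h y \<partial>lborel)" for h
    unfolding q_eq[abs_def] D_def using int0[of "x0 + h"] int0[of x0] int[of h] by simp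
  \<comment> \<open>Where |y - x0| is at least 2 |h| the Lipschitz estimate of the kernel applies;
    its factor |h| cancels 1/|h| and leaves a majorant independent of h.\<close>
  have far: "norm (indicator (- ball x0 (2 * norm h)) y *\<^sub>R q h y)
      \<le> K * ((real ?d + 1) * 2 ^ ?d + (real ?d + 1)) * L' * W y" (is "_ \<le> ?far y") for h y
  proof (cases "y \<in> ball x0 (2 * norm h) \<or> y = x0 \<or> h = 0")
    case True
    then show ?thesis
      using K(1) L'(1) W0[of y] Gx0 bounded_bilinear.zero_right[OF P]
      by (auto simp: q_def bounded_bilinear.zero_left[OF P])
  next
    case False
    let ?z = "y - x0"
    have z: "2 * norm h \<le> norm ?z" "?z \<noteq> 0" "h \<noteq> 0"
      using False by (auto simp: dist_norm norm_minus_commute)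
    have "norm (newton_kernel (?z - h) - newton_kernel ?z + newton_kernel_deriv ?z h)
        \<le> (real ?d + 1) * 2 ^ ?d * norm h / norm ?z ^ ?d + (real ?d + 1) * norm h / norm ?z ^ ?d"
      using newton_kernel_lipschitz[of "- h" ?z] z norm_newton_kernel_deriv_le[of ?z h]
      by (intro norm_triangle_mono) auto
    then have "norm ((1 / norm h) *\<^sub>R (newton_kernel (?z - h) - newton_kernel ?z + newton_kernel_deriv ?z h))
        \<le> (1 / norm h) * ((real ?d + 1) * 2 ^ ?d * norm h / norm ?z ^ ?d + (real ?d + 1) * norm h / norm ?z ^ ?d)"
      by (simp add: divide_right_mono)
    also have "\<dots> = ((real ?d + 1) * 2 ^ ?d + (real ?d + 1)) / norm ?z ^ ?d"
      using z by (simp add: field_simps)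
    finally have "norm (q h y) \<le> ?far y"
      unfolding q_def by (rule key) simp
    then show ?thesis
      using K(1) L'(1) W0[of y] by (auto simp: indicator_def)
  qed
  \<comment> \<open>Only size estimates are used here, but |G y| is at most 2 L' |h| and cancels
    1/|h|. The kernel at each of the two points carries weight 2 and its derivative d + 1, together
    d + 5.\<close>
  have near: "norm (\<integral>y. indicator (ball x0 (2 * norm h)) y *\<^sub>R q h y \<partial>lborel)
      \<le> K * L' * (real ?d + 5) * (2 ^ ?d * unit_ball_vol ?d * (3 * norm h))" if h: "h \<noteq> 0" for h
  proof -
    let ?w0 = "\<lambda>y. indicator (ball x0 (3 * norm h)) y * radial_weight (y - x0)"
    \<comment> \<open>The radius 3 |h| makes the ball around x0 + h contain the ball of radius 2 |h|
      around x0.\<close>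
    let ?w1 = "\<lambda>y. indicator (ball (x0 + h) (3 * norm h)) y * radial_weight (y - (x0 + h))"
    have h3: "3 * norm h > 0" using h by simp
    let ?b = "\<lambda>y. (K * L') * (2 * ?w1 y + (real ?d + 3) * ?w0 y)"
    note w0 = radial_weight_ball[OF h3, of x0] and w1 = radial_weight_ball[OF h3, of "x0 + h"]
    have le: "norm (indicator (ball x0 (2 * norm h)) y *\<^sub>R q h y) \<le> ?b y" for y
    proof (cases "y \<in> ball x0 (2 * norm h) \<and> y \<noteq> x0")
      case True
      let ?z = "y - x0"
      have z: "norm ?z \<le> 2 * norm h" "?z \<noteq> 0"
        using True by (auto simp: dist_norm norm_minus_commute)
      have in0: "y \<in> ball x0 (3 * norm h)"
        using True norm_ge_zero[of h] by (simp, linarith)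
      have "dist (x0 + h) y \<le> dist x0 y + norm h"
        using dist_triangle[of "x0 + h" y x0] by (simp add: dist_norm)
      then have in1: "y \<in> ball (x0 + h) (3 * norm h)"
        using True by simp
      let ?A = "newton_kernel (?z - h) - newton_kernel ?z"
      have "norm (P ((1 / norm h) *\<^sub>R ?A) (G y))
          \<le> ((1 / norm h) * (radial_weight (?z - h) + radial_weight ?z)) * (L' * (2 * norm h)) * K"
      proof (intro order_trans[OF K(2)] mult_right_mono mult_mono)
        have "norm ?A \<le> radial_weight (?z - h) + radial_weight ?z"
          by (intro order_trans[OF norm_triangle_ineq4] add_mono norm_newton_kernel_le)
        then show "norm ((1 / norm h) *\<^sub>R ?A) \<le> (1 / norm h) * (radial_weight (?z - h) + radial_weight ?z)"
          by (simp add: divide_right_mono)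
        show "norm (G y) \<le> L' * (2 * norm h)"
          using z L' by (intro order_trans[OF L'(2)[of y]] mult_left_mono) auto
      qed (use K(1) in \<open>auto intro!: divide_nonneg_nonneg\<close>)
      also have "\<dots> = K * L' * (2 * (radial_weight (?z - h) + radial_weight ?z))"
        using h by (simp add: field_simps)
      finally have 1: "norm (P ((1 / norm h) *\<^sub>R ?A) (G y))
        \<le> K * L' * (2 * (radial_weight (?z - h) + radial_weight ?z))" .
      have 2: "norm (P ((1 / norm h) *\<^sub>R newton_kernel_deriv ?z h) (G y)) \<le> K * L' * ((real ?d + 1) * W y)"
      proof -
        have "norm (P ((1 / norm h) *\<^sub>R newton_kernel_deriv ?z h) (G y))
            = (1 / norm h) * norm (P (newton_kernel_deriv ?z h) (G y))"
          by (simp add: bounded_bilinear.scaleR_left[OF P])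
        also have "\<dots> \<le> (1 / norm h) * (K * ((real ?d + 1) * norm h) * L' * W y)"
          by (intro mult_left_mono deriv_le) simp
        also have "\<dots> = K * L' * ((real ?d + 1) * W y)"
          using h by (simp add: field_simps)
        finally show ?thesis .
      qed
      have "W y \<le> radial_weight ?z"
        by (simp add: W_def indicator_def)
      then have 3: "K * L' * ((real ?d + 1) * W y) \<le> K * L' * ((real ?d + 1) * radial_weight ?z)"
        using K(1) L'(1) by (intro mult_left_mono) auto
      have "q h y = P ((1 / norm h) *\<^sub>R ?A) (G y) + P ((1 / norm h) *\<^sub>R newton_kernel_deriv ?z h) (G y)"
        by (simp only: q_def scaleR_add_right bounded_bilinear.add_left[OF P])
      then have "norm (q h y) \<le> norm (P ((1 / norm h) *\<^sub>R ?A) (G y)) + norm (P ((1 / norm h) *\<^sub>R newton_kernel_deriv ?z h) (G y))"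
        using norm_triangle_ineq by simp
      also have "\<dots> \<le> K * L' * (2 * (radial_weight (?z - h) + radial_weight ?z))
          + K * L' * ((real ?d + 1) * radial_weight ?z)"
        using 1 2 3 by linarith
      also have "\<dots> = ?b y"
        using in0 in1 by (simp add: diff_diff_eq algebra_simps)
      finally show ?thesis
        using True by simp
    next
      case False
      then have "indicator (ball x0 (2 * norm h)) y *\<^sub>R q h y = 0"
        using Gx0 bounded_bilinear.zero_right[OF P] by (auto simp: q_def)
      moreover have "0 \<le> ?b y"
        using K(1) L'(1) by (intro mult_nonneg_nonneg add_nonneg_nonneg) auto
      ultimately show ?thesis
        by (simp only: norm_zero)
    qed
    have b_int: "integrable lborel ?b"
      using w0(1) w1(1) by (intro integrable_mult_right Bochner_Integration.integrable_add)
    have "norm (\<integral>y. indicator (ball x0 (2 * norm h)) y *\<^sub>R q h y \<partial>lborel) \<le> (\<integral>y. ?b y \<partial>lborel)"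
      using b_int le by (intro Bochner_Integration.integral_norm_bound_integral AE_I2 integrable_mult_indicator q_int) auto
    also have "\<dots> = K * L' * (2 * (\<integral>y. ?w1 y \<partial>lborel) + (real ?d + 3) * (\<integral>y. ?w0 y \<partial>lborel))"
      using w0(1) w1(1) by simp
    also have "\<dots> \<le> K * L' * (2 * (2 ^ ?d * unit_ball_vol ?d * (3 * norm h))
        + (real ?d + 3) * (2 ^ ?d * unit_ball_vol ?d * (3 * norm h)))"
      using w0(2) w1(2) K(1) L'(1) by (intro mult_left_mono add_mono) auto
    also have "\<dots> = K * L' * (real ?d + 5) * (2 ^ ?d * unit_ball_vol ?d * (3 * norm h))"
      by (simp add: algebra_simps)
    finally show ?thesis .
  qed
  have near_lim: "((\<lambda>h. \<integral>y. indicator (ball x0 (2 * norm h)) y *\<^sub>R q h y \<partial>lborel) \<longlongrightarrow> 0) (at 0)"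
  proof (rule Lim_null_comparison)
    show "\<forall>\<^sub>F h in at 0. norm (\<integral>y. indicator (ball x0 (2 * norm h)) y *\<^sub>R q h y \<partial>lborel)
      \<le> K * L' * (real ?d + 5) * (2 ^ ?d * unit_ball_vol ?d * (3 * norm h))"
      using near by (auto simp: eventually_at_filter)
    have "((\<lambda>h::'e. K * L' * (real ?d + 5) * (2 ^ ?d * unit_ball_vol ?d * (3 * norm h)))
        \<longlongrightarrow> K * L' * (real ?d + 5) * (2 ^ ?d * unit_ball_vol ?d * (3 * norm (0::'e)))) (at 0)"
      by (intro tendsto_intros)
    then show "((\<lambda>h::'e. K * L' * (real ?d + 5) * (2 ^ ?d * unit_ball_vol ?d * (3 * norm h))) \<longlongrightarrow> 0) (at 0)"
      by simp
  qed
  \<comment> \<open>Pointwise convergence is the differentiability of the kernel at y - x0; at y =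
    x0 the density is zero.\<close>
  have q_lim: "((\<lambda>h. q h y) \<longlongrightarrow> 0) (at 0)" for y
  proof (cases "y = x0")
    case True
    then show ?thesis
      using Gx0 bounded_bilinear.zero_right[OF P] by (simp add: q_def)
  next
    case False
    let ?z = "y - x0"
    have "((\<lambda>h. newton_kernel (?z - h)) has_derivative (\<lambda>h. newton_kernel_deriv ?z (- h))) (at 0)"
    proof -
      have "(newton_kernel has_derivative newton_kernel_deriv ?z) (at (?z - 0))"
        using False by (simp add: has_derivative_newton_kernel)
      moreover have "((\<lambda>h. ?z - h) has_derivative (\<lambda>h. - h)) (at 0)"
        by (auto intro!: derivative_eq_intros)
      ultimately show ?thesis
        using has_derivative_compose[of "\<lambda>h. ?z - h" "\<lambda>h. - h" 0 UNIV newton_kernel] by simp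
    qed
    then have "((\<lambda>h. (1 / norm h) *\<^sub>R (newton_kernel (?z - h) - newton_kernel ?z + newton_kernel_deriv ?z h)) \<longlongrightarrow> 0) (at 0)"
      by (simp add: has_derivative_def linear_neg[OF linear_newton_kernel_deriv] inverse_eq_divide)
    from bounded_bilinear.tendsto[OF P this tendsto_const, of "G y"] show ?thesis
      by (simp add: q_def bounded_bilinear.zero_left[OF P])
  qed
  \<comment> \<open>Dominated convergence is applied along an arbitrary null sequence that avoids 0.
    The cut-off region varies with h, but the indicator never enlarges the integrand.\<close>
  have far_lim: "((\<lambda>h. \<integral>y. indicator (- ball x0 (2 * norm h)) y *\<^sub>R q h y \<partial>lborel) \<longlongrightarrow> 0) (at 0)"
    unfolding tendsto_at_iff_sequentially comp_def
  proof (intro allI impI)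
    fix X :: "nat \<Rightarrow> 'e"
    assume X: "\<forall>i. X i \<in> UNIV - {0}" "X \<longlonglongrightarrow> 0"
    have "(\<lambda>i. \<integral>y. indicator (- ball x0 (2 * norm (X i))) y *\<^sub>R q (X i) y \<partial>lborel) \<longlonglongrightarrow> (\<integral>y. 0 \<partial>(lborel :: 'e measure))"
    proof (rule integral_dominated_convergence)
      show "integrable lborel (\<lambda>y. K * ((real ?d + 1) * 2 ^ ?d + (real ?d + 1)) * L' * W y)"
        using W_int by (rule integrable_mult_right)
      show "AE y in lborel. norm (indicator (- ball x0 (2 * norm (X i))) y *\<^sub>R q (X i) y)
          \<le> K * ((real ?d + 1) * 2 ^ ?d + (real ?d + 1)) * L' * W y" for i
        by (intro AE_I2 far)
      show "AE y in lborel. (\<lambda>i. indicator (- ball x0 (2 * norm (X i))) y *\<^sub>R q (X i) y) \<longlonglongrightarrow> 0"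
      proof (rule AE_I2, rule Lim_null_comparison)
        fix y
        show "\<forall>\<^sub>F i in sequentially. norm (indicator (- ball x0 (2 * norm (X i))) y *\<^sub>R q (X i) y)
            \<le> norm (q (X i) y)"
          by (intro always_eventually allI) (simp add: indicator_def)
        show "(\<lambda>i. norm (q (X i) y)) \<longlonglongrightarrow> 0"
          using q_lim[of y] X by (intro tendsto_norm_zero) (auto simp: tendsto_at_iff_sequentially comp_def)
      qed
    qed measurable
    then show "(\<lambda>i. \<integral>y. indicator (- ball x0 (2 * norm (X i))) y *\<^sub>R q (X i) y \<partial>lborel) \<longlonglongrightarrow> 0"
      by simp
  qed
  have split: "(\<integral>y. q h y \<partial>lborel) = (\<integral>y. indicator (- ball x0 (2 * norm h)) y *\<^sub>R q h y \<partial>lborel)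
      + (\<integral>y. indicator (ball x0 (2 * norm h)) y *\<^sub>R q h y \<partial>lborel)" for h
  proof -
    have "(\<integral>y. q h y \<partial>lborel) = (\<integral>y. indicator (- ball x0 (2 * norm h)) y *\<^sub>R q h y
        + indicator (ball x0 (2 * norm h)) y *\<^sub>R q h y \<partial>lborel)"
      by (intro Bochner_Integration.integral_cong) (auto simp: indicator_def)
    also have "\<dots> = (\<integral>y. indicator (- ball x0 (2 * norm h)) y *\<^sub>R q h y \<partial>lborel)
      + (\<integral>y. indicator (ball x0 (2 * norm h)) y *\<^sub>R q h y \<partial>lborel)"
      by (intro Bochner_Integration.integral_add integrable_mult_indicator q_int) auto
    finally show ?thesis .
  qed
  have "((\<lambda>h. \<integral>y. q h y \<partial>lborel) \<longlongrightarrow> 0) (at 0)"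
    unfolding split using tendsto_add[OF far_lim near_lim] by simp
  then have "((\<lambda>h. (1 / norm h) *\<^sub>R ((\<integral>y. P (newton_kernel (y - (x0 + h))) (G y) \<partial>lborel)
      - (\<integral>y. P (newton_kernel (y - x0)) (G y) \<partial>lborel) - D h)) \<longlongrightarrow> 0) (at 0)"
    by (simp only: quot)
  from tendsto_norm_zero[OF this]
  have "((\<lambda>x. \<integral>y. P (newton_kernel (y - x)) (G y) \<partial>lborel) has_derivative D) (at x0)"
    using linD by (simp add: has_derivative_at linear_conv_bounded_linear)
  then show "((\<lambda>x. \<integral>y. P (newton_kernel (y - x)) (G y) \<partial>lborel) has_derivative
      (\<lambda>h. - (\<integral>y. P (newton_kernel_deriv (y - x0) h) (G y) \<partial>lborel))) (at x0)"
    by (simp only: D_def[abs_def])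
qed

section \<open>The potential of a ball\<close>

text \<open>In the factorisation of the difference of powers each of the n summands is at most
  b^(n-1).\<close>

lemma power_diff_le_mult:
  fixes a b :: real
  assumes "0 \<le> a" "a \<le> b"
  shows "b ^ n - a ^ n \<le> real n * b ^ (n - 1) * (b - a)"
proof -
  have "b ^ n - a ^ n = (b - a) * (\<Sum>i<n. a ^ (n - Suc i) * b ^ i)"
    by (rule power_diff_sumr2)
  also have "\<dots> \<le> (b - a) * (\<Sum>i<n. b ^ (n - 1))"
  proof (intro mult_left_mono sum_mono)
    fix i assume i: "i \<in> {..<n}"
    have "a ^ (n - Suc i) * b ^ i \<le> b ^ (n - Suc i) * b ^ i"
      using assms by (intro mult_right_mono power_mono) auto
    also have "\<dots> = b ^ (n - 1)"
      using i by (simp flip: power_add)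
    finally show "a ^ (n - Suc i) * b ^ i \<le> b ^ (n - 1)" .
  qed (use assms in auto)
  finally show ?thesis
    by (simp add: ac_simps)
qed

text \<open>A difference of two ball volumes; t \<le> R allows R + t to be replaced by 2 R, so that
  the bound is linear in t for fixed R.\<close>

lemma measure_lborel_annulus_le:
  fixes x :: "'e::euclidean_space"
  assumes "0 \<le> t" "t \<le> R"
  shows "measure lborel (ball x (R + t) - ball x (R - t))
    \<le> unit_ball_vol DIM('e) * (real DIM('e) * (2 * R) ^ (DIM('e) - 1) * (2 * t))"
proof -
  let ?d = "DIM('e)"
  have "measure lborel (ball x (R + t) - ball x (R - t))
      = measure lborel (ball x (R + t)) - measure lborel (ball x (R - t))"
    using assms emeasure_lborel_ball_finite[of x "R + t"]
    by (intro measure_Diff) (auto simp: less_top[symmetric])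
  also have "\<dots> = unit_ball_vol ?d * ((R + t) ^ ?d - (R - t) ^ ?d)"
    using assms by (simp add: content_ball right_diff_distrib)
  also have "\<dots> \<le> unit_ball_vol ?d * (real ?d * (R + t) ^ (?d - 1) * ((R + t) - (R - t)))"
    using assms by (intro mult_left_mono power_diff_le_mult) auto
  also have "\<dots> \<le> unit_ball_vol ?d * (real ?d * (2 * R) ^ (?d - 1) * (2 * t))"
    using assms by (intro mult_left_mono mult_mono power_mono) auto
  finally show ?thesis .
qed

text \<open>The indicator serves as a real density, and scalar multiplication with swapped arguments
  as the bilinear map.\<close>

lemma integrable_indicator_scaleR_newton_kernel:
  fixes a :: "'e::euclidean_space"
  shows "integrable lborel (\<lambda>y. indicator (ball a R) y *\<^sub>R newton_kernel (y - x))"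
proof -
  have "(indicator (ball a R) :: 'e \<Rightarrow> real) \<in> borel_measurable borel"
    by (intro borel_measurable_indicator) auto
  then show ?thesis
    by (rule integrable_newton_potential[OF bounded_bilinear.flip[OF bounded_bilinear_scaleR],
          where C = 1 and a = a and \<rho> = R]) (auto simp: indicator_def)
qed

text \<open>After a translation the difference quotient only sees a thin layer around the sphere of
  radius \<open>R\<close>, where the kernel may be replaced by the linear map \<open>z \<mapsto> z / R ^ DIM('e)\<close>,
  whose integral over a translated ball is explicit.\<close>

lemma has_derivative_ball_potential:
  fixes x0 :: "'e::euclidean_space"
  assumes R: "R > 0"
  shows "((\<lambda>x. \<integral>y. indicator (ball x0 R) y *\<^sub>R newton_kernel (y - x) \<partial>lborel) has_derivative
    (\<lambda>h. - (unit_ball_vol DIM('e) *\<^sub>R h))) (at x0)"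
proof -
  let ?d = "DIM('e)"
  let ?\<omega> = "unit_ball_vol DIM('e)"
  let ?K = "newton_kernel :: 'e \<Rightarrow> 'e"
  define J where "J z = (1 / R ^ ?d) *\<^sub>R z" for z :: 'e
  have [measurable]: "J \<in> borel_measurable borel"
    unfolding J_def[abs_def] by measurable
  have ball_meas: "(\<lambda>y. indicator (ball a r) y *\<^sub>R g y) \<in> borel_measurable borel"
    if "g \<in> borel_measurable borel" for a r and g :: "'e \<Rightarrow> 'e"
    using that by (intro borel_measurable_scaleR borel_measurable_indicator) auto
  have ind_int: "integrable lborel (\<lambda>y::'e. indicator (ball a r) y *\<^sub>R b)" for a r and b :: 'e
    using emeasure_lborel_ball_finite[of a r]
    by (intro integrable_scaleR_left integrable_real_indicator) auto
  have K_int: "integrable lborel (\<lambda>y. indicator (ball a R) y *\<^sub>R ?K y)" for a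
    using integrable_indicator_scaleR_newton_kernel[of a R 0] by simp
  have J_int: "integrable lborel (\<lambda>y. indicator (ball a R) y *\<^sub>R J y)" for a
  proof (rule Bochner_Integration.integrable_bound)
    have "integrable lborel (\<lambda>y::'e. indicator (ball a R) y *\<^sub>R ((1 / R ^ ?d) * (norm a + R)))"
      using emeasure_lborel_ball_finite[of a R]
      by (intro integrable_scaleR_left integrable_real_indicator) auto
    then show "integrable lborel (\<lambda>y::'e. indicator (ball a R) y *\<^sub>R ((1 / R ^ ?d) * (norm a + R)))" .
    show "AE y in lborel. norm (indicator (ball a R) y *\<^sub>R J y)
        \<le> norm (indicator (ball a R) y *\<^sub>R ((1 / R ^ ?d) * (norm a + R)))"
    proof (intro AE_I2)
      fix y
      have "norm y \<le> norm a + R" if "y \<in> ball a R"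
        using that norm_triangle_ineq[of a "y - a"] by (simp add: dist_norm norm_minus_commute)
      then show "norm (indicator (ball a R) y *\<^sub>R J y)
        \<le> norm (indicator (ball a R) y *\<^sub>R ((1 / R ^ ?d) * (norm a + R)))"
        using R by (auto simp: J_def indicator_def divide_right_mono)
    qed
  qed (use ball_meas in simp)
  have ball0: "indicator (ball 0 R) (- z) = (indicator (ball 0 R) z :: real)" for z :: 'e
    by (simp add: indicator_def)
  have K0: "(\<integral>y. indicator (ball 0 R) y *\<^sub>R ?K y \<partial>lborel) = 0"
    by (rule integral_odd_eq_0[OF ball_meas]) (simp_all add: ball0 newton_kernel_minus)
  have J0: "(\<integral>y. indicator (ball 0 R) y *\<^sub>R J y \<partial>lborel) = 0"
    by (rule integral_odd_eq_0[OF ball_meas]) (simp_all add: ball0 J_def)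
  \<comment> \<open>After translation to the centre c the linear map splits into the constant
    \<open>J c\<close> and an odd part that integrates to zero; the power R^d in the volume cancels
    the factor 1 / R^d.\<close>
  have Jc: "(\<integral>y. indicator (ball c R) y *\<^sub>R J y \<partial>lborel) = ?\<omega> *\<^sub>R c" for c
  proof -
    have "(\<integral>y. indicator (ball c R) y *\<^sub>R J y \<partial>lborel) = (\<integral>y. indicator (ball c R) (c + y) *\<^sub>R J (c + y) \<partial>lborel)"
      by (rule integral_translation[symmetric]) (rule ball_meas, measurable)
    also have "\<dots> = (\<integral>y. indicator (ball 0 R) y *\<^sub>R J c + indicator (ball 0 R) y *\<^sub>R J y \<partial>lborel)"
      by (intro Bochner_Integration.integral_cong) (auto simp: indicator_def J_def dist_norm scaleR_add_right)
    also have "\<dots> = (\<integral>y. indicator (ball (0::'e) R) y *\<^sub>R J c \<partial>lborel)"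
      using J_int[of 0] J0 ind_int[of 0 R "J c"] by simp
    also have "\<dots> = measure lborel (ball (0::'e) R) *\<^sub>R J c"
      using emeasure_lborel_ball_finite[of "0::'e" R] by simp
    also have "\<dots> = ?\<omega> *\<^sub>R c"
      using R by (simp add: J_def content_ball)
    finally show ?thesis .
  qed
  \<comment> \<open>Moving x0 + h to the origin fixes the kernel and shifts the ball
    instead.\<close>
  have shift: "(\<integral>y. indicator (ball x0 R) y *\<^sub>R ?K (y - (x0 + h)) \<partial>lborel)
      = (\<integral>z. indicator (ball (- h) R) z *\<^sub>R ?K z \<partial>lborel)" for h
  proof -
    have "(\<integral>y. indicator (ball x0 R) y *\<^sub>R ?K (y - (x0 + h)) \<partial>lborel)
        = (\<integral>z. indicator (ball x0 R) ((x0 + h) + z) *\<^sub>R ?K ((x0 + h) + z - (x0 + h)) \<partial>lborel)"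
      by (rule integral_translation[symmetric]) (rule ball_meas, measurable)
    also have "\<dots> = (\<integral>z. indicator (ball (- h) R) z *\<^sub>R ?K z \<partial>lborel)"
      by (intro Bochner_Integration.integral_cong)
        (auto simp: indicator_def dist_norm norm_minus_commute algebra_simps)
    finally show ?thesis .
  qed
  \<comment> \<open>Both \<open>newton_kernel\<close> and \<open>J\<close> integrate to zero over
    the centred ball, so subtracting its indicator is free. What remains lives on the symmetric
    difference of the two balls.\<close>
  define Q where "Q c z = (indicator (ball c R) z - indicator (ball 0 R) z) *\<^sub>R (?K z - J z)" for c z
  have Q_int: "integrable lborel (Q c)" for c
    unfolding Q_def[abs_def] scaleR_diff_left scaleR_diff_right
    using K_int[of c] J_int[of c] K_int[of 0] J_int[of 0] by simp
  have Q_eq: "(\<integral>z. indicator (ball c R) z *\<^sub>R ?K z \<partial>lborel) = ?\<omega> *\<^sub>R c + (\<integral>z. Q c z \<partial>lborel)" for c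
    unfolding Q_def[abs_def] scaleR_diff_left scaleR_diff_right
    using K_int[of c] J_int[of c] K_int[of 0] J_int[of 0] by (simp add: K0 J0 Jc)
  define A where "A = ?\<omega> * (real ?d * (2 * R) ^ (?d - 1) * 2)"
  have A: "A \<ge> 0"
    using R by (simp add: A_def)
  have "((\<lambda>h. norm (\<integral>z. Q (- h) z \<partial>lborel) / norm h) \<longlongrightarrow> 0) (at 0)"
  proof (rule tendstoI)
    fix e :: real assume e: "e > 0"
    \<comment> \<open>\<open>A * norm h\<close> will bound the volume of the layer. Dividing by A +
      1 avoids a zero denominator and makes e' A < e strict.\<close>
    define e' where "e' = e / (A + 1)"
    have e': "e' > 0" using e A by (simp add: e'_def)
    \<comment> \<open>With u = |z| this is, up to sign, the norm of
      \<open>newton_kernel z - J z\<close>. The limit is punctured, so |z| = R is treated separately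
      below.\<close>
    have "((\<lambda>u. (1 / u ^ ?d - 1 / R ^ ?d) * u) \<longlongrightarrow> (1 / R ^ ?d - 1 / R ^ ?d) * R) (at R)"
      using R by (intro tendsto_intros) auto
    then have "\<forall>\<^sub>F u in at R. \<bar>(1 / u ^ ?d - 1 / R ^ ?d) * u\<bar> < e'"
      using e' by (auto dest!: tendstoD simp: dist_real_def)
    then obtain \<delta> where \<delta>: "\<delta> > 0" "\<And>u. u \<noteq> R \<Longrightarrow> dist u R < \<delta> \<Longrightarrow> \<bar>(1 / u ^ ?d - 1 / R ^ ?d) * u\<bar> < e'"
      by (auto simp: eventually_at)
    have KJ: "norm (?K z - J z) \<le> e'" if "\<bar>norm z - R\<bar> < \<delta>" for z
    proof -
      have "norm (?K z - J z) = \<bar>(1 / norm z ^ ?d - 1 / R ^ ?d) * norm z\<bar>"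
        unfolding newton_kernel_def J_def by (simp add: abs_mult flip: scaleR_diff_left)
      also have "\<dots> \<le> e'"
        using \<delta>(2)[of "norm z"] that e' by (cases "norm z = R") (auto simp: dist_real_def)
      finally show ?thesis .
    qed
    have "norm (\<integral>z. Q (- h) z \<partial>lborel) / norm h < e" if h: "h \<noteq> 0" "norm h < min \<delta> R" for h
    proof -
      let ?t = "norm h"
      let ?S = "ball (0::'e) (R + ?t) - ball 0 (R - ?t)"
      have le: "norm (Q (- h) z) \<le> e' * indicator ?S z" for z
      proof (cases "z \<in> ?S")
        case True
        then have "\<bar>norm z - R\<bar> < \<delta>"
          using h(2) by auto
        then show ?thesis
          using KJ[of z] True e' by (auto simp: Q_def indicator_def)
      next
        case False
        have tri: "\<bar>dist (- h) z - norm z\<bar> \<le> ?t"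
          using norm_triangle_ineq3[of "z + h" z] by (simp add: dist_norm norm_minus_commute add.commute)
        \<comment> \<open>Off the layer either |z| < R - |h| or |z| \<ge> R + |h|, so moving the
          centre by |h| does not change membership in the ball.\<close>
        have "indicator (ball (- h) R) z = (indicator (ball 0 R) z :: real)"
          using False tri by (auto simp: indicator_def)
        then show ?thesis
          using e' by (simp add: Q_def)
      qed
      have S_fin: "emeasure lborel ?S < \<infinity>"
        by (rule order_le_less_trans[OF emeasure_mono emeasure_lborel_ball_finite[of "0::'e" "R + ?t"]]) auto
      have "norm (\<integral>z. Q (- h) z \<partial>lborel) \<le> (\<integral>z. e' * indicator ?S z \<partial>lborel)"
        using le S_fin by (intro Bochner_Integration.integral_norm_bound_integral AE_I2 Q_int integrable_mult_right integrable_real_indicator) auto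
      also have "\<dots> = e' * measure lborel ?S"
        by simp
      also have "\<dots> \<le> e' * (A * ?t)"
        using measure_lborel_annulus_le[of ?t R "0::'e"] h e' by (intro mult_left_mono) (auto simp: A_def ac_simps)
      also have "\<dots> < e * ?t"
      proof -
        have "e' * A < e"
          using e A by (simp add: e'_def divide_less_eq mult_less_cancel_left)
        then show ?thesis
          using h(1) by (simp flip: mult.assoc)
      qed
      finally show ?thesis
        using h(1) by (simp add: divide_less_eq)
    qed
    then show "\<forall>\<^sub>F h in at 0. dist (norm (\<integral>z. Q (- h) z \<partial>lborel) / norm h) 0 < e"
      using \<delta>(1) R unfolding eventually_at by (intro exI[of _ "min \<delta> R"]) auto
  qed
  moreover have "bounded_linear (\<lambda>h::'e. - (?\<omega> *\<^sub>R h))"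
    by (intro bounded_linear_minus bounded_linear_scaleR_right)
  moreover have "(\<integral>y. indicator (ball x0 R) y *\<^sub>R ?K (y - (x0 + h)) \<partial>lborel)
      - (\<integral>y. indicator (ball x0 R) y *\<^sub>R ?K (y - x0) \<partial>lborel) - - (?\<omega> *\<^sub>R h) = (\<integral>z. Q (- h) z \<partial>lborel)" for h
    using shift[of 0] K0 by (simp add: shift Q_eq)
  ultimately show ?thesis
    by (simp add: has_derivative_at)
qed

text \<open>Both balls have the same potential to first order at the common centre.\<close>

lemma integral_newton_kernel_deriv_annulus:
  fixes x0 h :: "'e::euclidean_space"
  assumes "0 < \<epsilon>" "\<epsilon> < R"
  shows "integrable lborel (\<lambda>y. indicator (ball x0 R - ball x0 \<epsilon>) y *\<^sub>R newton_kernel_deriv (y - x0) h)"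
    and "(\<integral>y. indicator (ball x0 R - ball x0 \<epsilon>) y *\<^sub>R newton_kernel_deriv (y - x0) h \<partial>lborel) = 0"
proof -
  let ?S = "ball x0 R - ball x0 \<epsilon>"
  let ?D = "\<lambda>h. \<integral>y. indicator ?S y *\<^sub>R newton_kernel_deriv (y - x0) h \<partial>lborel"
  have S: "(indicator ?S :: 'e \<Rightarrow> real) \<in> borel_measurable borel"
    by (intro borel_measurable_indicator) auto
  \<comment> \<open>The indicator vanishes for |y - x0| < \<epsilon>, so it obeys the first-order
    bound at x0 with constant 1 / \<epsilon>.\<close>
  have lip: "norm (indicator ?S y :: real) \<le> (1 / \<epsilon>) * norm (y - x0)" for y
    using assms by (auto simp: indicator_def dist_norm norm_minus_commute le_divide_eq)
  have supp: "y \<notin> ball x0 R \<Longrightarrow> indicator ?S y = (0::real)" for y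
    by auto
  note * = has_derivative_newton_potential_vanishing
    [OF bounded_bilinear.flip[OF bounded_bilinear_scaleR] S lip supp]
  show "integrable lborel (\<lambda>y. indicator ?S y *\<^sub>R newton_kernel_deriv (y - x0) h)"
    by (rule *(1))
  have "(\<integral>y. indicator ?S y *\<^sub>R newton_kernel (y - x) \<partial>lborel)
      = (\<integral>y. indicator (ball x0 R) y *\<^sub>R newton_kernel (y - x) \<partial>lborel)
      - (\<integral>y. indicator (ball x0 \<epsilon>) y *\<^sub>R newton_kernel (y - x) \<partial>lborel)" for x
  proof -
    have "(\<integral>y. indicator ?S y *\<^sub>R newton_kernel (y - x) \<partial>lborel)
       = (\<integral>y. indicator (ball x0 R) y *\<^sub>R newton_kernel (y - x)
           - indicator (ball x0 \<epsilon>) y *\<^sub>R newton_kernel (y - x) \<partial>lborel)"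
      using assms by (intro Bochner_Integration.integral_cong) (auto simp: indicator_def)
    then show ?thesis
      by (simp add: integrable_indicator_scaleR_newton_kernel)
  qed
  \<comment> \<open>The derivative of a ball potential at its centre is free of the radius, so the
    two cancel.\<close>
  moreover have "((\<lambda>x. (\<integral>y. indicator (ball x0 R) y *\<^sub>R newton_kernel (y - x) \<partial>lborel)
      - (\<integral>y. indicator (ball x0 \<epsilon>) y *\<^sub>R newton_kernel (y - x) \<partial>lborel)) has_derivative (\<lambda>h. 0)) (at x0)"
    using assms has_derivative_diff[OF has_derivative_ball_potential[of R x0] has_derivative_ball_potential[of \<epsilon> x0]]
    by simp
  ultimately have "((\<lambda>x. \<integral>y. indicator ?S y *\<^sub>R newton_kernel (y - x) \<partial>lborel) has_derivative (\<lambda>h. 0)) (at x0)"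
    by simp
  from has_derivative_unique[OF *(2) this] have "- ?D h = 0"
    by meson
  then show "?D h = 0"
    by simp
qed

section \<open>Potentials of bounded densities and their principal values\<close>

text \<open>Cutting the density off near x0 makes it vanish to first order there, with constant C /
  \<epsilon>, so the absolutely convergent case applies.\<close>

lemma integrable_newton_kernel_deriv_off_ball:
  fixes P :: "'e::euclidean_space \<Rightarrow> 'b::euclidean_space \<Rightarrow> 'c::{banach,second_countable_topology}"
  assumes P: "bounded_bilinear P"
    and F: "F \<in> borel_measurable borel" and bdd: "\<And>y. norm (F y) \<le> C"
    and supp: "\<And>y. y \<notin> ball x0 \<rho> \<Longrightarrow> F y = 0" and "\<epsilon> > 0"
  shows "integrable lborel (\<lambda>y. indicator (- ball x0 \<epsilon>) y *\<^sub>R P (newton_kernel_deriv (y - x0) h) (F y))"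
proof -
  let ?G = "\<lambda>y. indicator (- ball x0 \<epsilon>) y *\<^sub>R F y"
  have C: "0 \<le> C"
    using bdd[of x0] norm_ge_zero order_trans by blast
  have "integrable lborel (\<lambda>y. P (newton_kernel_deriv (y - x0) h) (?G y))"
  proof (rule has_derivative_newton_potential_vanishing(1)[OF P])
    show "?G \<in> borel_measurable borel"
      using F by (intro borel_measurable_scaleR borel_measurable_indicator) auto
    show "norm (?G y) \<le> (C / \<epsilon>) * norm (y - x0)" for y
    proof (cases "y \<in> ball x0 \<epsilon>")
      case True
      then show ?thesis using C \<open>\<epsilon> > 0\<close> by simp
    next
      case False
      then have "C * 1 \<le> C * (norm (y - x0) / \<epsilon>)"
        using \<open>\<epsilon> > 0\<close> C by (intro mult_left_mono) (auto simp: dist_norm norm_minus_commute)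
      then show ?thesis
        using False bdd[of y] by simp
    qed
    show "y \<notin> ball x0 \<rho> \<Longrightarrow> ?G y = 0" for y
      using supp by simp
  qed
  then show ?thesis
    by (simp add: bounded_bilinear.scaleR_right[OF P])
qed

text \<open>The principal value J is realised as an absolutely convergent integral against
  \<open>G\<close>, the density minus its value at x0 on a ball; the constant removed produces the
  local term.\<close>

theorem has_derivative_newton_potential:
  fixes P :: "'e::euclidean_space \<Rightarrow> 'b::euclidean_space \<Rightarrow> 'c::{banach,second_countable_topology}"
  assumes P: "bounded_bilinear P"
    and F[measurable]: "F \<in> borel_measurable borel" and bdd: "\<And>y. norm (F y) \<le> C"
    and supp: "\<And>y. y \<notin> ball x0 \<rho> \<Longrightarrow> F y = 0"
    and R: "R > 0" and lip: "\<And>y. y \<in> ball x0 R \<Longrightarrow> norm (F y - F x0) \<le> L * norm (y - x0)"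
  obtains J where
    "\<And>h. ((\<lambda>\<epsilon>. \<integral>y. indicator (- ball x0 \<epsilon>) y *\<^sub>R P (newton_kernel_deriv (y - x0) h) (F y) \<partial>lborel)
      \<longlongrightarrow> J h) (at_right 0)"
    "((\<lambda>x. \<integral>y. P (newton_kernel (y - x)) (F y) \<partial>lborel) has_derivative
      (\<lambda>h. - J h - unit_ball_vol DIM('e) *\<^sub>R P h (F x0))) (at x0)"
proof -
  let ?\<omega> = "unit_ball_vol DIM('e)"
  define G where "G y = F y - indicator (ball x0 R) y *\<^sub>R F x0" for y
  have ind_meas: "(indicator (ball x0 R) :: 'e \<Rightarrow> real) \<in> borel_measurable borel"
    by (intro borel_measurable_indicator) auto
  then have G[measurable]: "G \<in> borel_measurable borel"
    unfolding G_def[abs_def] by measurable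
  have C: "0 \<le> C"
    using bdd[of x0] norm_ge_zero order_trans by blast
  \<comment> \<open>Inside the ball this is the Lipschitz hypothesis; outside it |y - x0| is at
    least R, so the bound C becomes C / R times |y - x0|.\<close>
  have Glip: "norm (G y) \<le> (\<bar>L\<bar> + C / R) * norm (y - x0)" for y
  proof (cases "y \<in> ball x0 R")
    case True
    have "norm (G y) \<le> L * norm (y - x0)"
      using lip[OF True] True by (simp add: G_def)
    also have "\<dots> \<le> (\<bar>L\<bar> + C / R) * norm (y - x0)"
      using C R by (intro mult_right_mono) (auto simp: add_increasing2)
    finally show ?thesis .
  next
    case False
    then have "C * 1 \<le> C * (norm (y - x0) / R)"
      using R C by (intro mult_left_mono) (auto simp: dist_norm norm_minus_commute)
    then have "norm (G y) \<le> C / R * norm (y - x0)"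
      using False bdd[of y] by (simp add: G_def)
    also have "\<dots> \<le> (\<bar>L\<bar> + C / R) * norm (y - x0)"
      by (intro mult_right_mono) auto
    finally show ?thesis .
  qed
  have Gsupp: "G y = 0" if "y \<notin> ball x0 (max R \<rho>)" for y
    using that supp by (simp add: G_def)
  note G_diff = has_derivative_newton_potential_vanishing[OF P G Glip Gsupp]
  define J where "J h = (\<integral>y. P (newton_kernel_deriv (y - x0) h) (G y) \<partial>lborel)" for h
  have F_eq: "F y = G y + indicator (ball x0 R) y *\<^sub>R F x0" for y
    by (simp add: G_def)
  have Gbdd: "norm (G y) \<le> C + C" for y
  proof -
    have "norm (indicator (ball x0 R) y *\<^sub>R F x0) \<le> C"
      using bdd[of x0] C by (simp add: indicator_def)
    then show ?thesis
      unfolding G_def using bdd[of y] norm_triangle_ineq4[of "F y" "indicator (ball x0 R) y *\<^sub>R F x0"] by linarith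
  qed
  have "((\<lambda>x. \<integral>y. P (newton_kernel (y - x)) (F y) \<partial>lborel) has_derivative
      (\<lambda>h. - J h - ?\<omega> *\<^sub>R P h (F x0))) (at x0)"
  proof -
    have "(\<integral>y. P (newton_kernel (y - x)) (F y) \<partial>lborel) = (\<integral>y. P (newton_kernel (y - x)) (G y) \<partial>lborel)
        + P (\<integral>y. indicator (ball x0 R) y *\<^sub>R newton_kernel (y - x) \<partial>lborel) (F x0)" for x
    proof -
      note lin = bounded_bilinear.bounded_linear_left[OF P, of "F x0"]
      note int = integrable_indicator_scaleR_newton_kernel[of x0 R x]
      have "P (newton_kernel (y - x)) (F y) = P (newton_kernel (y - x)) (G y)
          + P (indicator (ball x0 R) y *\<^sub>R newton_kernel (y - x)) (F x0)" for y
        by (subst F_eq) (simp add: bounded_bilinear.add_right[OF P] bounded_bilinear.scaleR_right[OF P]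
            bounded_bilinear.scaleR_left[OF P])
      moreover have "integrable lborel (\<lambda>y. P (newton_kernel (y - x)) (G y))"
        by (rule integrable_newton_potential[OF P G Gbdd Gsupp])
      ultimately show ?thesis
        using integrable_bounded_linear[OF lin int] integral_bounded_linear[OF lin int]
        by simp
    qed
    moreover have "((\<lambda>x. (\<integral>y. P (newton_kernel (y - x)) (G y) \<partial>lborel)
        + P (\<integral>y. indicator (ball x0 R) y *\<^sub>R newton_kernel (y - x) \<partial>lborel) (F x0)) has_derivative
       (\<lambda>h. - J h + P (- (?\<omega> *\<^sub>R h)) (F x0))) (at x0)"
      unfolding J_def
      by (intro has_derivative_add G_diff(2)
          bounded_linear.has_derivative[OF bounded_bilinear.bounded_linear_left[OF P]]
          has_derivative_ball_potential R)
    ultimately show ?thesis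
      by (simp add: bounded_bilinear.minus_left[OF P] bounded_bilinear.scaleR_left[OF P])
  qed
  moreover have "((\<lambda>\<epsilon>. \<integral>y. indicator (- ball x0 \<epsilon>) y *\<^sub>R P (newton_kernel_deriv (y - x0) h) (F y) \<partial>lborel)
      \<longlongrightarrow> J h) (at_right 0)" for h
  proof -
    let ?g = "\<lambda>y. P (newton_kernel_deriv (y - x0) h) (G y)"
    \<comment> \<open>For \<epsilon> < R the two cut-off integrals differ by that of a constant
      density on the annulus between \<epsilon> and R, which is zero.\<close>
    have eq: "(\<integral>y. indicator (- ball x0 \<epsilon>) y *\<^sub>R P (newton_kernel_deriv (y - x0) h) (F y) \<partial>lborel)
       = (\<integral>y. indicator (- ball x0 \<epsilon>) y *\<^sub>R ?g y \<partial>lborel)" if \<epsilon>: "0 < \<epsilon>" "\<epsilon> < R" for \<epsilon>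
    proof -
      note lin = bounded_bilinear.bounded_linear_left[OF P, of "F x0"]
      note ann = integral_newton_kernel_deriv_annulus[OF \<epsilon>, of x0 h]
      have "indicator (- ball x0 \<epsilon>) y *\<^sub>R P (newton_kernel_deriv (y - x0) h) (F y)
          = indicator (- ball x0 \<epsilon>) y *\<^sub>R ?g y
          + P (indicator (ball x0 R - ball x0 \<epsilon>) y *\<^sub>R newton_kernel_deriv (y - x0) h) (F x0)" for y
        by (subst F_eq) (simp add: bounded_bilinear.add_right[OF P] bounded_bilinear.scaleR_right[OF P]
            bounded_bilinear.scaleR_left[OF P] scaleR_add_right indicator_def)
      moreover have "integrable lborel (\<lambda>y. indicator (- ball x0 \<epsilon>) y *\<^sub>R ?g y)"
        by (intro integrable_mult_indicator G_diff(1)) auto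
      ultimately show ?thesis
        using integrable_bounded_linear[OF lin ann(1)] integral_bounded_linear[OF lin ann(1)] ann(2)
        by (simp add: bounded_bilinear.zero_left[OF P])
    qed
    have "((\<lambda>\<epsilon>. \<integral>y. indicator (- ball x0 \<epsilon>) y *\<^sub>R ?g y \<partial>lborel) \<longlongrightarrow> J h) (at_right 0)"
      unfolding tendsto_at_iff_sequentially comp_def
    proof (intro allI impI)
      fix X :: "nat \<Rightarrow> real"
      assume X: "\<forall>i. X i \<in> {0<..} - {0}" "X \<longlonglongrightarrow> 0"
      show "(\<lambda>i. \<integral>y. indicator (- ball x0 (X i)) y *\<^sub>R ?g y \<partial>lborel) \<longlonglongrightarrow> J h"
        unfolding J_def
      proof (rule integral_dominated_convergence)
        show "?g \<in> borel_measurable lborel"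
          using G_diff(1) by (rule borel_measurable_integrable)
        show "(\<lambda>y. indicator (- ball x0 (X i)) y *\<^sub>R ?g y) \<in> borel_measurable lborel" for i
          using G_diff(1) by (intro borel_measurable_integrable integrable_mult_indicator) auto
        show "integrable lborel (\<lambda>y. norm (?g y))"
          using G_diff(1) by (rule integrable_norm)
        show "AE y in lborel. norm (indicator (- ball x0 (X i)) y *\<^sub>R ?g y) \<le> norm (?g y)" for i
          by (intro AE_I2) (simp add: indicator_def)
        show "AE y in lborel. (\<lambda>i. indicator (- ball x0 (X i)) y *\<^sub>R ?g y) \<longlonglongrightarrow> ?g y"
        proof (rule AE_I2)
          fix y
          \<comment> \<open>At y = x0 all terms and the limit are zero because \<open>G x0\<close>
            is; any other y eventually lies outside the shrinking ball.\<close>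
          show "(\<lambda>i. indicator (- ball x0 (X i)) y *\<^sub>R ?g y) \<longlonglongrightarrow> ?g y"
          proof (cases "y = x0")
            case True
            then show ?thesis
              using Glip[of x0] bounded_bilinear.zero_right[OF P] by simp
          next
            case False
            then have "\<forall>\<^sub>F i in sequentially. X i < dist x0 y"
              using X(2) by (intro order_tendstoD) auto
            then have "\<forall>\<^sub>F i in sequentially. indicator (- ball x0 (X i)) y *\<^sub>R ?g y = ?g y"
              by eventually_elim simp
            then show ?thesis
              by (rule tendsto_eventually)
          qed
        qed
      qed
    qed
    moreover have "\<forall>\<^sub>F \<epsilon> in at_right 0. 0 < \<epsilon> \<and> \<epsilon> < R"
      using R by (auto simp: eventually_at_right)
    ultimately show ?thesis
      by (elim Lim_transform_eventually) (auto elim!: eventually_mono simp: eq)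
  qed
  ultimately show ?thesis
    using that by blast
qed

section \<open>The Cauchy kernel in an alternative algebra\<close>

lemma bounded_bilinear_alt_mult:
  "bounded_bilinear ((*) :: 'a::{euclidean_space,alternative_star_algebra} \<Rightarrow> 'a \<Rightarrow> 'a)"
  unfolding bilinear_conv_bounded_bilinear[symmetric] bilinear_def
  by (auto intro!: linearI simp: alt_mult_add_left alt_mult_add_right alt_mult_scaleR_left
      alt_mult_scaleR_right)

lemma linear_star: "linear (star :: 'a::alternative_star_algebra \<Rightarrow> 'a)"
  by (auto intro!: linearI simp: star_add star_scaleR)

lemma linear_embed: "linear (embed v)"
  by (auto intro!: linearI simp: embed_def scaleR_add_left sum.distrib scaleR_sum_right)

lemma embed_axis [simp]: "embed v (axis s 1) = v s"
proof -
  have "embed v (axis s 1) = (\<Sum>t\<in>UNIV. if t = s then v t else 0)"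
    unfolding embed_def by (intro sum.cong) (auto simp: axis_def)
  then show ?thesis
    by simp
qed

text \<open>The family v is orthonormal, since injectivity sends distinct indices to distinct
  elements of W. This matches the norm in the Cauchy kernel with the one in coordinates.\<close>

lemma norm_embed:
  fixes v :: "'n::finite \<Rightarrow> 'a::euclidean_space"
  assumes "inj v" "range v \<subseteq> W" "orthonormal_basis W"
  shows "norm (embed v x) = norm x"
proof -
  have inner: "v s \<bullet> v t = (if s = t then 1 else 0)" for s t
  proof (cases "s = t")
    case True
    then show ?thesis
      using assms(2,3) by (auto simp: orthonormal_basis_def dot_square_norm image_subset_iff)
  next
    case False
    then have "v s \<noteq> v t" "v s \<in> W" "v t \<in> W"
      using assms(1,2) by (auto dest: injD)
    then show ?thesis
      using assms(3) False by (auto simp: orthonormal_basis_def pairwise_def orthogonal_def)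
  qed
  have "(norm (embed v x))\<^sup>2 = (\<Sum>s\<in>UNIV. \<Sum>t\<in>UNIV. x $ s * (x $ t * (v t \<bullet> v s)))"
    by (simp add: embed_def power2_norm_eq_inner inner_sum_left inner_sum_right sum_distrib_left)
  also have "\<dots> = (\<Sum>s\<in>UNIV. (x $ s)\<^sup>2)"
    by (simp add: inner power2_eq_square if_distrib[of "(*) _"] cong: if_cong)
  also have "\<dots> = (norm x)\<^sup>2"
    unfolding power2_norm_eq_inner inner_vec_def by (simp add: power2_eq_square)
  finally show ?thesis
    by simp
qed

section \<open>Basis relations from the left alternative law\<close>

text \<open>Expand the left alternative law at x + y and cancel the pure terms.\<close>

lemma left_alternative_polarised:
  fixes x y b :: "'a::alternative_star_algebra"
  shows "x * (y * b) + y * (x * b) = (x * y + y * x) * b"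
proof -
  have alt: "a * (a * b) = (a * a) * b" for a
    using associator_alternating(1)[of a b] by simp
  have "(x + y) * ((x + y) * b) = ((x + y) * (x + y)) * b"
    by (rule alt)
  then show ?thesis
    by (simp add: alt_mult_add_left alt_mult_add_right alt algebra_simps)
qed

text \<open>For nonzero indices conjugation is a sign, so by the polarised law the left side is
  -(v_s v_t + v_t v_s) a, which v_s^2 = -1 and anticommutation evaluate. Index 0 is direct because
  v_0 = 1.\<close>

lemma basis_star_mult:
  fixes v :: "'n::{finite,zero} \<Rightarrow> 'a::{euclidean_space,alternative_star_algebra}"
  assumes v: "hypercomplex_basis M v"
  shows "v s * (star (v t) * a) + v t * (star (v s) * a) = (if s = t then 2 *\<^sub>R a else 0)"
proof -
  have neg: "(- x) * y = - (x * y)" "x * (- y) = - (x * y)" for x y :: 'a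
    using alt_mult_scaleR_left[of "-1" x y] alt_mult_scaleR_right[of x "-1" y] by auto
  have v0: "v 0 = 1"
    using v by (simp add: hypercomplex_basis_def)
  have star1: "star (1::'a) = 1"
    using star_real[of 1] by simp
  have st: "star (v s) = - v s" "v s * v s = - 1" if "s \<noteq> 0" for s
  proof -
    have "v s + star (v s) = 0" "v s * star (v s) = 1"
      using v that by (auto simp: hypercomplex_basis_def imag_sphere_def alg_trace_def alg_norm_def)
    then show "star (v s) = - v s"
      by (simp add: add_eq_0_iff)
    with \<open>v s * star (v s) = 1\<close> have "- (v s * v s) = 1"
      by (simp add: neg)
    then have "- (- (v s * v s)) = - 1"
      by (rule arg_cong)
    then show "v s * v s = - 1"
      by (simp only: minus_minus)
  qed
  have anti: "v s * v t + v t * v s = 0" if "s \<noteq> 0" "t \<noteq> 0" "s \<noteq> t"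
  proof -
    have "v s * v t = - (v t * v s)"
      using v that unfolding hypercomplex_basis_def by blast
    then show ?thesis
      by (simp only: left_minus)
  qed
  consider "s = 0" | "t = 0" | "s \<noteq> 0" "t \<noteq> 0" by blast
  then show ?thesis
  proof cases
    case 1
    then show ?thesis
      by (cases "t = 0") (auto simp: v0 star1 st neg alt_one_mult scaleR_2)
  next
    case 2
    then show ?thesis
      by (cases "s = 0") (auto simp: v0 star1 st neg alt_one_mult scaleR_2)
  next
    case 3
    have "v s * (star (v t) * a) + v t * (star (v s) * a) = - ((v s * v t + v t * v s) * a)"
      unfolding left_alternative_polarised[symmetric] using 3 by (simp add: st neg)
    also have "\<dots> = (if s = t then 2 *\<^sub>R a else 0)"
    proof (cases "s = t")
      case True
      have "(v t * v t) * a = - a"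
        using 3 by (simp add: st neg alt_one_mult)
      with True show ?thesis
        by (simp add: alt_mult_add_left scaleR_2)
    next
      case False
      then show ?thesis
        using anti[OF 3] alt_mult_scaleR_left[of 0 0 a] by simp
    qed
    finally show ?thesis .
  qed
qed

text \<open>The identity z (z^c a) = |z|^2 a, with the left factor expanded in the basis.\<close>

lemma embed_star_embed_mult:
  fixes v :: "'n::{finite,zero} \<Rightarrow> 'a::{euclidean_space,alternative_star_algebra}"
  assumes v: "hypercomplex_basis M v"
  shows "(\<Sum>s\<in>UNIV. z $ s *\<^sub>R (v s * (star (embed v z) * a))) = (norm z)\<^sup>2 *\<^sub>R a"
proof -
  define B where "B s t = v s * (star (v t) * a)" for s t
  have B: "B s t + B t s = (if s = t then 2 *\<^sub>R a else 0)" for s t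
    unfolding B_def by (rule basis_star_mult[OF v])
  have lin: "linear (\<lambda>x. v s * (star x * a))" for s
    by (auto intro!: linearI simp: star_add star_scaleR alt_mult_add_left alt_mult_add_right
        alt_mult_scaleR_left alt_mult_scaleR_right)
  have "v s * (star (embed v z) * a) = (\<Sum>t\<in>UNIV. z $ t *\<^sub>R B s t)" for s
    unfolding embed_def linear_sum[OF lin] linear_cmul[OF lin] B_def ..
  then have eq: "(\<Sum>s\<in>UNIV. z $ s *\<^sub>R (v s * (star (embed v z) * a)))
      = (\<Sum>s\<in>UNIV. \<Sum>t\<in>UNIV. (z $ s * z $ t) *\<^sub>R B s t)" (is "_ = ?S")
    by (simp add: scaleR_sum_right)
  \<comment> \<open>Adding the sum with exchanged indices brings in \<open>B s t + B t s\<close>, of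
    which only the diagonal survives.\<close>
  have "?S = (\<Sum>s\<in>UNIV. \<Sum>t\<in>UNIV. (z $ s * z $ t) *\<^sub>R B t s)"
    by (subst sum.swap) (simp add: mult.commute)
  then have "?S + ?S = (\<Sum>s\<in>UNIV. \<Sum>t\<in>UNIV. (z $ s * z $ t) *\<^sub>R (B s t + B t s))"
    by (simp add: scaleR_add_right sum.distrib)
  also have "\<dots> = (\<Sum>s\<in>UNIV. (z $ s * z $ s) *\<^sub>R (2 *\<^sub>R a))"
    by (simp add: B if_distrib[of "scaleR _"] cong: if_cong)
  also have "\<dots> = (2 * (norm z)\<^sup>2) *\<^sub>R a"
    by (simp add: power2_norm_eq_inner inner_vec_def sum_distrib_left scaleR_sum_left ac_simps)
  finally have "2 *\<^sub>R ?S = 2 *\<^sub>R ((norm z)\<^sup>2 *\<^sub>R a)"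
    by (simp add: scaleR_2[symmetric])
  then show ?thesis
    unfolding eq by (rule scaleR_left_imp_eq[rotated]) simp
qed

lemma sum_basis_star_basis_mult:
  fixes v :: "'n::{finite,zero} \<Rightarrow> 'a::{euclidean_space,alternative_star_algebra}"
  assumes v: "hypercomplex_basis M v"
  shows "(\<Sum>s\<in>UNIV. v s * (star (v s) * a)) = real CARD('n) *\<^sub>R a"
proof -
  have "v s * (star (v s) * a) = a" for s
    using basis_star_mult[OF v, of s s a] by (simp add: scaleR_2[symmetric])
  then show ?thesis
    by (simp add: sum_constant_scaleR)
qed

section \<open>The Cauchy kernel through the Newton kernel\<close>

text \<open>For w = \<open>newton_kernel z\<close>, an isometric embedding and d = m + 1 this is
  E(z) a. It gathers the algebra into one bilinear map to which the potential estimates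
  apply.\<close>

definition cauchy_product ::
    "nat \<Rightarrow> ('n::finite \<Rightarrow> 'a::{euclidean_space,alternative_star_algebra}) \<Rightarrow> real ^ 'n \<Rightarrow> 'a \<Rightarrow> 'a"
  where "cauchy_product m v w a = (1 / sphere_area m) *\<^sub>R (star (embed v w) * a)"

lemma bounded_bilinear_cauchy_product: "bounded_bilinear (cauchy_product m v)"
  unfolding bilinear_conv_bounded_bilinear[symmetric] bilinear_def cauchy_product_def
  by (auto intro!: linearI simp: linear_add[OF linear_embed] linear_cmul[OF linear_embed] star_add star_scaleR
      alt_mult_add_left alt_mult_add_right alt_mult_scaleR_left alt_mult_scaleR_right scaleR_add_right)

lemma cauchy_product_one_mult: "cauchy_product m v w 1 * a = cauchy_product m v w a"
  by (simp add: cauchy_product_def alt_mult_one alt_mult_scaleR_left)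

text \<open>The embedding is linear and isometric, conjugation is linear, and the cardinality makes
  the exponents agree; at y = x both sides are 0.\<close>

lemma kernel_at_eq:
  fixes v :: "'n::finite \<Rightarrow> 'a::{euclidean_space,alternative_star_algebra}"
  assumes "inj v" "range v \<subseteq> W" "orthonormal_basis W" "CARD('n) = m + 1"
  shows "kernel_at m v y x = cauchy_product m v (newton_kernel (y - x)) 1"
proof -
  have "embed v y - embed v x = embed v (y - x)"
    by (simp add: linear_diff[OF linear_embed])
  then show ?thesis
    using assms(4) by (simp add: kernel_at_def cauchy_kernel_def cauchy_product_def newton_kernel_def
        norm_embed[OF assms(1-3)] linear_cmul[OF linear_embed] star_scaleR alt_mult_one)
qed

lemma partial_eq_derivative:
  assumes "(F has_derivative F') (at x)"
  shows "partial s F x = F' (axis s 1)"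
proof -
  have "((\<lambda>t. x + t *\<^sub>R axis s 1) has_derivative (\<lambda>t. t *\<^sub>R axis s 1)) (at 0)"
    by (auto intro!: derivative_eq_intros)
  moreover have "(F has_derivative F') (at (x + 0 *\<^sub>R axis s 1))"
    using assms by simp
  ultimately have "((\<lambda>t. F (x + t *\<^sub>R axis s 1)) has_derivative (\<lambda>t. F' (t *\<^sub>R axis s 1))) (at 0)"
    by (rule has_derivative_compose)
  then have "((\<lambda>t. F (x + t *\<^sub>R axis s 1)) has_vector_derivative F' (axis s 1)) (at 0)"
    using linear_cmul[OF has_derivative_linear[OF assms]] by (simp add: has_vector_derivative_def)
  then show ?thesis
    by (simp add: partial_def vector_derivative_at)
qed

lemma partial_kernel_at:
  fixes v :: "'n::finite \<Rightarrow> 'a::{euclidean_space,alternative_star_algebra}"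
  assumes "inj v" "range v \<subseteq> W" "orthonormal_basis W" "CARD('n) = m + 1" and "y \<noteq> x"
  shows "partial s (kernel_at m v y) x * a = - cauchy_product m v (newton_kernel_deriv (y - x) (axis s 1)) a"
proof -
  note P = bounded_bilinear_cauchy_product[of m v]
  have "(newton_kernel has_derivative newton_kernel_deriv (y - x)) (at (y - x))"
    using assms(5) by (simp add: has_derivative_newton_kernel)
  moreover have "((\<lambda>x. y - x) has_derivative (\<lambda>h. - h)) (at x)"
    by (auto intro!: derivative_eq_intros)
  ultimately have "((\<lambda>x. newton_kernel (y - x)) has_derivative (\<lambda>h. newton_kernel_deriv (y - x) (- h))) (at x)"
    using has_derivative_compose[of "\<lambda>x. y - x" "\<lambda>h. - h" x UNIV newton_kernel] by simp
  then have "((\<lambda>x. cauchy_product m v (newton_kernel (y - x)) 1) has_derivative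
      (\<lambda>h. cauchy_product m v (newton_kernel_deriv (y - x) (- h)) 1)) (at x)"
    by (rule bounded_linear.has_derivative[OF bounded_bilinear.bounded_linear_left[OF P]])
  then have "(kernel_at m v y has_derivative
      (\<lambda>h. cauchy_product m v (newton_kernel_deriv (y - x) (- h)) 1)) (at x)"
    by (simp only: kernel_at_eq[OF assms(1-4), abs_def] eta_contract_eq)
  from partial_eq_derivative[OF this, of s] show ?thesis
    by (simp add: cauchy_product_one_mult bounded_bilinear.minus_left[OF bounded_bilinear_alt_mult] linear_neg[OF linear_newton_kernel_deriv] bounded_bilinear.minus_left[OF P])
qed

text \<open>The Cauchy-Riemann operator annihilates the kernel; the factor a stays inside the
  product for want of associativity. For z \<noteq> 0 the two parts of the derivative each sum to d
  a / |z|^d, up to the common factor, and cancel.\<close>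

lemma dbar_kernel_eq_0:
  fixes v :: "'n::{finite,zero} \<Rightarrow> 'a::{euclidean_space,alternative_star_algebra}"
  assumes v: "hypercomplex_basis M v"
  shows "(\<Sum>s\<in>UNIV. v s * cauchy_product m v (newton_kernel_deriv z (axis s 1)) a) = 0"
proof (cases "z = 0")
  case True
  then show ?thesis
    using bounded_bilinear.zero_left[OF bounded_bilinear_cauchy_product, of m v a]
      bounded_bilinear.zero_right[OF bounded_bilinear_alt_mult[where 'a='a]]
    by (simp add: newton_kernel_deriv_def power_0_left)
next
  case False
  let ?d = "CARD('n)"
  let ?c = "1 / norm z ^ ?d" and ?e = "real ?d / norm z ^ (?d + 2)"
  have "v s * cauchy_product m v (newton_kernel_deriv z (axis s 1)) a
      = (1 / sphere_area m) *\<^sub>R (?c *\<^sub>R (v s * (star (v s) * a))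
        - ?e *\<^sub>R (z $ s *\<^sub>R (v s * (star (embed v z) * a))))" for s
  proof -
    note mult = bounded_bilinear_alt_mult[where 'a='a]
    show ?thesis
      unfolding cauchy_product_def newton_kernel_deriv_def
      by (simp add: linear_diff[OF linear_embed] linear_cmul[OF linear_embed] linear_diff[OF linear_star]
        linear_cmul[OF linear_star] bounded_bilinear.diff_left[OF mult] bounded_bilinear.diff_right[OF mult]
        alt_mult_scaleR_left alt_mult_scaleR_right inner_axis)
  qed
  then have "(\<Sum>s\<in>UNIV. v s * cauchy_product m v (newton_kernel_deriv z (axis s 1)) a)
      = (1 / sphere_area m) *\<^sub>R (?c *\<^sub>R (real ?d *\<^sub>R a) - ?e *\<^sub>R ((norm z)\<^sup>2 *\<^sub>R a))"
    by (simp only: scaleR_sum_right[symmetric] sum_subtractf embed_star_embed_mult[OF v] sum_basis_star_basis_mult[OF v])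
  also have "\<dots> = 0"
    using False by (simp add: power_add power2_eq_square)
  finally show ?thesis .
qed

section \<open>The normalising constant and a Lipschitz bound\<close>

text \<open>With Gamma(1/2) = sqrt pi this comes down to Gamma(z + 1) = z Gamma(z) at z = (m + 1) /
  2.\<close>

lemma sphere_area_eq: "sphere_area m = (real m + 1) * unit_ball_vol (real m + 1)"
proof -
  let ?z = "(real m + 1) / 2"
  have "pi powr ?z = (pi powr (1/2)) powr real (m + 1)"
    unfolding powr_powr by (simp add: add.commute)
  also have "\<dots> = sqrt pi ^ (m + 1)"
    by (subst powr_realpow) (simp_all add: powr_half_sqrt)
  finally have "pi powr ?z = sqrt pi ^ (m + 1)" .
  moreover have "Gamma (?z + 1) = ?z * Gamma ?z"
    by (intro Gamma_plus1) (auto simp: nonpos_Ints_def dest: arg_cong[of _ _ "\<lambda>x. x > 0"])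
  moreover have "0 < Gamma ?z"
    by (rule Gamma_real_pos) simp
  moreover define G where "G = Gamma ?z"
  ultimately have "unit_ball_vol (real m + 1) = sqrt pi ^ (m + 1) / (?z * G)" "0 < G"
    by (simp_all only: unit_ball_vol_def)
  then show ?thesis
    unfolding sphere_area_def Gamma_one_half_real G_def[symmetric]
    by (simp only: times_divide_eq_right) (simp add: divide_simps)
qed

text \<open>Only partial derivatives are given, so y is reached from x0 one coordinate at a time;
  each move costs at most C |y - x0| by the one-dimensional mean value inequality.\<close>

lemma lipschitz_at_of_partials:
  fixes f :: "real ^ 'n::finite \<Rightarrow> 'a::real_normed_vector"
  assumes part: "\<And>s x. x \<in> ball x0 R \<Longrightarrow> has_partial s f (D s x) x"
    and bdd: "\<And>s x. x \<in> ball x0 R \<Longrightarrow> norm (D s x) \<le> C" and y: "y \<in> ball x0 R"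
  shows "norm (f y - f x0) \<le> (real CARD('n) * C) * norm (y - x0)"
proof -
  define h where "h = y - x0"
  have h: "norm h < R"
    using y by (simp add: h_def dist_norm norm_minus_commute)
  have C: "0 \<le> C"
    using bdd[OF y] norm_ge_zero order_trans by blast
  define p where "p S = (\<chi> i. if i \<in> S then h $ i else 0)" for S
  have "norm (f (x0 + p S) - f x0) \<le> real (card S) * (C * norm h)" if "finite S" for S
    using that
  proof (induction S)
    case empty
    have "p {} = 0"
      by (simp add: p_def vec_eq_iff)
    then show ?case by simp
  next
    case (insert s S)
    define g where "g t = f (x0 + p S + t *\<^sub>R axis s 1)" for t :: real
    \<comment> \<open>No coordinate of the displacement exceeds that of h in absolute value, so the
      path stays in the ball.\<close>
    have in_ball: "x0 + p S + t *\<^sub>R axis s 1 \<in> ball x0 R" if "t \<in> closed_segment 0 (h $ s)" for t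
    proof -
      have "\<bar>t\<bar> \<le> \<bar>h $ s\<bar>"
        using that by (auto simp: closed_segment_eq_real_ivl split: if_splits)
      then have "norm (p S + t *\<^sub>R axis s 1) \<le> norm h"
        using insert.hyps by (intro norm_le_componentwise_cart) (auto simp: p_def axis_def)
      moreover have "dist x0 (x0 + w) = norm w" for w
        by (simp add: dist_norm)
      ultimately show ?thesis
        using h by (simp only: mem_ball add.assoc)
    qed
    have "norm (g (h $ s) - g 0) \<le> C * norm (h $ s - 0)"
    proof (rule differentiable_bound[of "closed_segment 0 (h $ s)" g
          "\<lambda>t u. u *\<^sub>R D s (x0 + p S + t *\<^sub>R axis s 1)" C])
      fix t assume t: "t \<in> closed_segment 0 (h $ s)"
      let ?q = "x0 + p S + t *\<^sub>R axis s 1"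
      \<comment> \<open>\<open>has_partial\<close> speaks of the parameter 0; written as t - t, it
        becomes the image of t under u \<mapsto> u - t.\<close>
      have "((\<lambda>u. f (?q + u *\<^sub>R axis s 1)) has_derivative (\<lambda>u. u *\<^sub>R D s ?q)) (at (t - t))"
        using part[OF in_ball[OF t]] by (simp add: has_partial_def has_vector_derivative_def)
      moreover have "((\<lambda>u. u - t) has_derivative (\<lambda>u. u)) (at t within closed_segment 0 (h $ s))"
        by (auto intro!: derivative_eq_intros)
      ultimately have "((\<lambda>u. f (?q + (u - t) *\<^sub>R axis s 1)) has_derivative (\<lambda>u. u *\<^sub>R D s ?q))
          (at t within closed_segment 0 (h $ s))"
        using has_derivative_compose[of "\<lambda>u. u - t" "\<lambda>u. u" t "closed_segment 0 (h $ s)"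
            "\<lambda>u. f (?q + u *\<^sub>R axis s 1)"] by blast
      then show "(g has_derivative (\<lambda>u. u *\<^sub>R D s ?q)) (at t within closed_segment 0 (h $ s))"
        by (simp add: g_def[abs_def] scaleR_diff_left add.assoc)
      show "onorm (\<lambda>u. u *\<^sub>R D s ?q) \<le> C"
      proof (rule onorm_le)
        show "norm (u *\<^sub>R D s ?q) \<le> C * norm u" for u
          using mult_right_mono[OF bdd[OF in_ball[OF t], of s], of "norm u"] by (simp add: mult.commute)
      qed
    qed auto
    also have "\<dots> \<le> C * norm h"
      using component_le_norm_cart[of h s] C by (intro mult_left_mono) auto
    finally have "norm (g (h $ s) - g 0) \<le> C * norm h" .
    moreover have "p (insert s S) = p S + h $ s *\<^sub>R axis s 1"
      using insert.hyps by (auto simp: p_def vec_eq_iff axis_def)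
    ultimately have "norm (f (x0 + p (insert s S)) - f (x0 + p S)) \<le> C * norm h"
      by (simp add: g_def add.assoc)
    then have "norm (f (x0 + p (insert s S)) - f x0) \<le> C * norm h + real (card S) * (C * norm h)"
      using norm_triangle_ineq[of "f (x0 + p (insert s S)) - f (x0 + p S)" "f (x0 + p S) - f x0"] insert.IH
      by simp
    then show ?case
      using insert.hyps by (simp add: algebra_simps)
  qed
  from this[of UNIV] have "norm (f (x0 + p UNIV) - f x0) \<le> real CARD('n) * (C * norm h)"
    by simp
  moreover have "x0 + p UNIV = y"
    by (simp add: p_def h_def vec_eq_iff)
  ultimately show ?thesis
    by (simp add: h_def mult.assoc)
qed

section \<open>The Teodorescu transform\<close>

theorem theorem3p8:
  fixes M W :: "'a::{euclidean_space,alternative_star_algebra} set"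
    and v :: "'n::{finite,zero} \<Rightarrow> 'a"
    and m :: nat
    and \<Omega> :: "(real ^ 'n::{finite,zero}) set"
    and f :: "real ^ 'n::{finite,zero} \<Rightarrow> 'a"
  assumes "DIM('a) > 1"
    and "(imag_sphere :: 'a set) \<noteq> {}"
    and "m \<ge> 1" and "CARD('n) = m + 1"
    and "hypercomplex_subspace M" and "hypercomplex_basis M v"
    and "range v \<subseteq> W" and "orthonormal_basis W"
    and "open \<Omega>" and "connected \<Omega>" and "bounded \<Omega>" and "smooth_boundary \<Omega>"
    and "C1_closure \<Omega> f"
  shows "\<forall>x\<in>\<Omega>.
    set_integrable lborel \<Omega> (\<lambda>y. kernel_at m v y x * f y) \<and>
    teodorescu m v \<Omega> f differentiable (at x) \<and>
    (\<forall>s. \<exists>I. has_pv_integral \<Omega> x (\<lambda>y. partial s (kernel_at m v y) x * f y) I \<and>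
       partial s (teodorescu m v \<Omega> f) x = - I + (1 / (real m + 1)) *\<^sub>R (star (v s) * f x)) \<and>
    dbar v (teodorescu m v \<Omega> f) x = f x"
proof
  fix x assume x: "x \<in> \<Omega>"
  have "inj v"
    using assms(6) by (simp add: hypercomplex_basis_def)
  note basis = this assms(7,8,4)
  note mult = bounded_bilinear_alt_mult[where 'a='a]
  define P where "P = cauchy_product m v"
  have P: "bounded_bilinear P"
    unfolding P_def by (rule bounded_bilinear_cauchy_product)
  \<comment> \<open>Extension by zero gives a bounded density on the whole space with bounded
    support; it is Lipschitz at x because a ball around x lies in \<Omega>.\<close>
  define F where "F y = indicator \<Omega> y *\<^sub>R f y" for y
  have kernel: "kernel_at m v y z * f y = P (newton_kernel (y - z)) (f y)" for y z
    by (simp add: kernel_at_eq[OF basis] P_def cauchy_product_one_mult)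
  have pkernel: "partial s (kernel_at m v y) x * f y = - P (newton_kernel_deriv (y - x) (axis s 1)) (f y)"
    if "y \<noteq> x" for s y
    unfolding P_def by (rule partial_kernel_at[OF basis that])

  have compact: "compact (closure \<Omega>)"
    using assms(11) by simp
  obtain D where D: "continuous_on (closure \<Omega>) f" "\<And>s z. z \<in> \<Omega> \<Longrightarrow> has_partial s f (D s z) z"
      "\<And>s. continuous_on (closure \<Omega>) (D s)"
    using assms(13) unfolding C1_closure_def by metis
  have bounded_on: "\<exists>C. \<forall>z\<in>\<Omega>. norm (g z) \<le> C" if "continuous_on (closure \<Omega>) g" for g :: "real ^ 'n::{finite,zero} \<Rightarrow> 'a"
    using compact_imp_bounded[OF compact_continuous_image[OF that compact]] closure_subset[of \<Omega>]
    unfolding bounded_iff by auto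
  obtain C where C: "\<And>z. z \<in> \<Omega> \<Longrightarrow> norm (f z) \<le> C"
    using bounded_on[OF D(1)] by blast
  obtain c where c: "\<And>s z. z \<in> \<Omega> \<Longrightarrow> norm (D s z) \<le> c s"
    using bounded_on[OF D(3)] by metis
  have c_sum: "norm (D s z) \<le> (\<Sum>s\<in>UNIV. \<bar>c s\<bar>)" if "z \<in> \<Omega>" for s z
  proof -
    have "\<bar>c s\<bar> \<le> (\<Sum>s\<in>UNIV. \<bar>c s\<bar>)"
      by (rule member_le_sum) auto
    then show ?thesis
      using c[OF that, of s] by linarith
  qed
  obtain R where R: "R > 0" "ball x R \<subseteq> \<Omega>"
    using assms(9) x open_contains_ball by blast
  obtain \<rho> where \<rho>: "\<Omega> \<subseteq> ball x \<rho>"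
    using bounded_subset_ballD[OF assms(11)] by blast

  have F_meas: "F \<in> borel_measurable borel"
    unfolding F_def[abs_def]
    using assms(9) continuous_on_subset[OF D(1) closure_subset]
    by (intro borel_measurable_continuous_on_indicator) auto
  have F_bdd: "norm (F y) \<le> C" for y
    using C[of y] order_trans[OF norm_ge_zero C[OF x]] by (simp add: F_def indicator_def)
  have F_supp: "F y = 0" if "y \<notin> ball x \<rho>" for y
  proof -
    have "y \<notin> \<Omega>"
      using that \<rho> by blast
    then show ?thesis
      by (simp add: F_def)
  qed
  have F_lip: "norm (F y - F x) \<le> (real CARD('n) * (\<Sum>s\<in>UNIV. \<bar>c s\<bar>)) * norm (y - x)" if "y \<in> ball x R" for y
  proof -
    have "norm (f y - f x) \<le> (real CARD('n) * (\<Sum>s\<in>UNIV. \<bar>c s\<bar>)) * norm (y - x)"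
      by (rule lipschitz_at_of_partials[OF _ _ that, of f D]) (use R D(2) c_sum in auto)
    then show ?thesis
      using subsetD[OF R(2) that] x by (simp add: F_def)
  qed
  obtain J where
    J: "\<And>h. ((\<lambda>\<epsilon>. \<integral>y. indicator (- ball x \<epsilon>) y *\<^sub>R P (newton_kernel_deriv (y - x) h) (F y) \<partial>lborel)
        \<longlongrightarrow> J h) (at_right 0)" and
    deriv: "((\<lambda>z. \<integral>y. P (newton_kernel (y - z)) (F y) \<partial>lborel) has_derivative
        (\<lambda>h. - J h - unit_ball_vol DIM(real ^ 'n::{finite,zero}) *\<^sub>R P h (F x))) (at x)"
    using has_derivative_newton_potential[OF P F_meas F_bdd F_supp R(1) F_lip] by blast

  have T_eq: "teodorescu m v \<Omega> f = (\<lambda>z. - (\<integral>y. P (newton_kernel (y - z)) (F y) \<partial>lborel))"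
    by (simp add: fun_eq_iff teodorescu_def set_lebesgue_integral_def kernel F_def
        bounded_bilinear.scaleR_right[OF P])
  have T_deriv: "(teodorescu m v \<Omega> f has_derivative
      (\<lambda>h. J h + unit_ball_vol DIM(real ^ 'n::{finite,zero}) *\<^sub>R P h (F x))) (at x)"
    unfolding T_eq using has_derivative_minus[OF deriv] by (simp add: add.commute)
  have "0 < unit_ball_vol (1 + real m)"
    by (rule unit_ball_vol_pos) simp
  then have "unit_ball_vol (1 + real m) \<noteq> 0"
    by (rule less_imp_neq[symmetric])
  \<comment> \<open>Nonvanishing of the ball volume lets it cancel against
    \<open>sphere_area m\<close>; this is where the factor 1 / (m + 1) arises.\<close>
  then have "unit_ball_vol DIM(real ^ 'n::{finite,zero}) / sphere_area m = 1 / (real m + 1)"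
    using assms(4) by (simp add: sphere_area_eq add.commute)
  then have T_partial: "partial s (teodorescu m v \<Omega> f) x
      = J (axis s 1) + (1 / (real m + 1)) *\<^sub>R (star (v s) * f x)" for s
    using x unfolding partial_eq_derivative[OF T_deriv]
    by (simp add: P_def cauchy_product_def F_def)

  \<comment> \<open>At y = x both indicators vanish, so the kernel derivative matters only off the
    singularity.\<close>
  have pv_eq: "indicator (\<Omega> - ball x \<epsilon>) y *\<^sub>R (partial s (kernel_at m v y) x * f y)
      = - (indicator (- ball x \<epsilon>) y *\<^sub>R P (newton_kernel_deriv (y - x) (axis s 1)) (F y))"
    if "\<epsilon> > 0" for \<epsilon> s y
    using that pkernel[of y s] bounded_bilinear.zero_right[OF P]
    by (cases "y = x") (auto simp: indicator_def F_def)
  have pv_integrable: "integrable lborel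
      (\<lambda>y. indicator (- ball x \<epsilon>) y *\<^sub>R P (newton_kernel_deriv (y - x) h) (F y))" if "\<epsilon> > 0" for \<epsilon> h
    using P F_meas F_bdd F_supp that by (rule integrable_newton_kernel_deriv_off_ball)
  \<comment> \<open>Differentiating in x instead of y - x flips the sign, whence
    \<open>- J (axis s 1)\<close>.\<close>
  have pv: "has_pv_integral \<Omega> x (\<lambda>y. partial s (kernel_at m v y) x * f y) (- J (axis s 1))" for s
    unfolding has_pv_integral_def
  proof (intro conjI allI impI)
    show "set_integrable lborel (\<Omega> - ball x \<epsilon>) (\<lambda>y. partial s (kernel_at m v y) x * f y)" if "\<epsilon> > 0" for \<epsilon>
      unfolding set_integrable_def pv_eq[OF that] using pv_integrable[OF that] by simp
    have "\<forall>\<^sub>F \<epsilon> in at_right 0. - (\<integral>y. indicator (- ball x \<epsilon>) y *\<^sub>R P (newton_kernel_deriv (y - x) (axis s 1)) (F y) \<partial>lborel)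
        = (LINT y:\<Omega> - ball x \<epsilon>|lborel. partial s (kernel_at m v y) x * f y)"
      unfolding set_lebesgue_integral_def
      by (rule eventually_at_rightI[of 0 1]) (simp_all add: pv_eq)
    then show "((\<lambda>\<epsilon>. LINT y:\<Omega> - ball x \<epsilon>|lborel. partial s (kernel_at m v y) x * f y) \<longlongrightarrow> - J (axis s 1)) (at_right 0)"
      by (rule Lim_transform_eventually[OF tendsto_minus[OF J]])
  qed

  \<comment> \<open>The cut-off integrals already satisfy this: multiplication by \<open>v s\<close>
    moves under the integral, where the sum vanishes pointwise. Then \<epsilon> tends to 0.\<close>
  have J_sum: "(\<Sum>s\<in>UNIV. v s * J (axis s 1)) = 0"
  proof (rule tendsto_unique)
    let ?I = "\<lambda>\<epsilon> s. \<integral>y. indicator (- ball x \<epsilon>) y *\<^sub>R P (newton_kernel_deriv (y - x) (axis s 1)) (F y) \<partial>lborel"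
    show "((\<lambda>\<epsilon>. \<Sum>s\<in>UNIV. v s * ?I \<epsilon> s) \<longlongrightarrow> (\<Sum>s\<in>UNIV. v s * J (axis s 1))) (at_right 0)"
      by (intro tendsto_sum bounded_bilinear.tendsto[OF mult] tendsto_const J)
    have "(\<Sum>s\<in>UNIV. v s * ?I \<epsilon> s) = 0" if "\<epsilon> > 0" for \<epsilon>
    proof -
      note lin = bounded_bilinear.bounded_linear_right[OF mult]
      note int = pv_integrable[OF that]
      have "(\<Sum>s\<in>UNIV. v s * ?I \<epsilon> s) = (\<Sum>s\<in>UNIV. \<integral>y. v s * (indicator (- ball x \<epsilon>) y *\<^sub>R
          P (newton_kernel_deriv (y - x) (axis s 1)) (F y)) \<partial>lborel)"
        by (simp add: integral_bounded_linear[OF lin int])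
      also have "\<dots> = (\<integral>y. (\<Sum>s\<in>UNIV. v s * (indicator (- ball x \<epsilon>) y *\<^sub>R
          P (newton_kernel_deriv (y - x) (axis s 1)) (F y))) \<partial>lborel)"
        by (intro Bochner_Integration.integral_sum[symmetric] integrable_bounded_linear[OF lin int])
      also have "\<dots> = 0"
        by (simp add: alt_mult_scaleR_right P_def dbar_kernel_eq_0[OF assms(6)] flip: scaleR_sum_right)
      finally show ?thesis .
    qed
    then show "((\<lambda>\<epsilon>. \<Sum>s\<in>UNIV. v s * ?I \<epsilon> s) \<longlongrightarrow> 0) (at_right 0)"
      by (intro tendsto_eventually eventually_at_rightI[of 0 1]) auto
  qed simp

  have "dbar v (teodorescu m v \<Omega> f) x = f x"
  proof -
    have "dbar v (teodorescu m v \<Omega> f) x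
        = (\<Sum>s\<in>UNIV. v s * J (axis s 1)) + (1 / (real m + 1)) *\<^sub>R (\<Sum>s\<in>UNIV. v s * (star (v s) * f x))"
      by (simp add: dbar_def T_partial alt_mult_add_right alt_mult_scaleR_right sum.distrib scaleR_sum_right)
    \<comment> \<open>The local terms add up to (m + 1) f(x) before division by m + 1.\<close>
    then show ?thesis
      using assms(4) by (simp add: J_sum sum_basis_star_basis_mult[OF assms(6)] add.commute)
  qed
  moreover have "set_integrable lborel \<Omega> (\<lambda>y. kernel_at m v y x * f y)"
    using integrable_newton_potential[OF P F_meas F_bdd F_supp, of x]
    by (simp add: set_integrable_def kernel F_def bounded_bilinear.scaleR_right[OF P])
  moreover have "teodorescu m v \<Omega> f differentiable (at x)"
    using T_deriv by (rule differentiableI)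
  moreover have "\<exists>I. has_pv_integral \<Omega> x (\<lambda>y. partial s (kernel_at m v y) x * f y) I \<and>
      partial s (teodorescu m v \<Omega> f) x = - I + (1 / (real m + 1)) *\<^sub>R (star (v s) * f x)" for s
    by (rule exI[of _ "- J (axis s 1)"]) (simp add: pv T_partial)
  ultimately show "set_integrable lborel \<Omega> (\<lambda>y. kernel_at m v y x * f y) \<and>
    teodorescu m v \<Omega> f differentiable (at x) \<and>
    (\<forall>s. \<exists>I. has_pv_integral \<Omega> x (\<lambda>y. partial s (kernel_at m v y) x * f y) I \<and>
       partial s (teodorescu m v \<Omega> f) x = - I + (1 / (real m + 1)) *\<^sub>R (star (v s) * f x)) \<and>
    dbar v (teodorescu m v \<Omega> f) x = f x"
    by blast
qed

end
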